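(* Let $\mathcal{A}$ be the free complex associative unital algebra on $x^1,\dots,x^n$, let $\xi:\mathcal{A}\to \mathrm{Mat}_n(\mathcal{A})$ be an algebra homomorphism, and let $\mathcal{M}$, $d^1$, $D_k$, $\mathcal{M}^{(2)}$, $\mathcal{E}=\mathcal{M}\oplus\mathcal{M}^{(2)}$, the $\mathbb{N}$-graded tensor algebra $T_{\mathcal{A}}\mathcal{E}=\bigoplus_{m\ge 0}T^m$, the grade-one linear map $d:T_{\mathcal{A}}\mathcal{E}\to T_{\mathcal{A}}\mathcal{E}$, and the homogeneous two-sided ideal $I_q=\bigoplus_{m\ge0} I_q^{(m)}\subset T_{\mathcal{A}}\mathcal{E}$ be as defined in the context, with $q=e^{2\pi i/3}$. Let $$\Omega(\mathcal{A},\mathcal{M})=T_{\mathcal{A}}\mathcal{E}/I_q=\bigoplus_{m\ge 0}\Omega^{(m)}(\mathcal{A},\mathcal{M}),\qquad \Omega^{(m)}(\mathcal{A},\mathcal{M})=T^m/I_q^{(m)}.$$ Then the map $d$ on $T_{\mathcal{A}}\mathcal{E}$ gives a (well-defined) operator $d:\Omega(\mathcal{A},\mathcal{M})\to\Omega(\mathcal{A},\mathcal{M})$ on the quotient, and the pair $\{\Omega(\mathcal{A},\mathcal{M}),d\}$ is an $\mathbb{N}$-graded differential algebra with ternary differential; that is, $d^3=d\circ d\circ d=0$ on $\Omega(\mathcal{A},\mathcal{M})$ and the $q$-Leibniz rule $$d(\omega\theta)=(d\omega)\,\theta+q^{m}\,\omega\,(d\theta)$$ holds for all $m\ge 0$,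 $\omega\in\Omega^{(m)}(\mathcal{A},\mathcal{M})$ and $\theta\in\Omega(\mathcal{A},\mathcal{M})$.
   Context: Throughout $q=e^{2\pi i/3}$, so $1+q+q^2=0$; $[2]_q=1+q$. Repeated indices (one upper, one lower) are summed from $1$ to $n$. First order calculus. $\mathcal{A}$ is the free complex associative unital algebra with generators $x^1,\dots,x^n$. $\mathcal{M}$ is the free right $\mathcal{A}$-module with basis $dx^1,\dots,dx^n$. An algebra homomorphism $\xi=(\xi^j_k):\mathcal{A}\to\mathrm{Mat}_n(\mathcal{A})$ (unital, with product convention $\xi(uv)^j_l=\xi(u)^k_l\,\xi(v)^j_k$) makes $\mathcal{M}$ a bimodule by $u\,dx^j=dx^k\,\xi(u)^j_k$ for $u\in\mathcal{A}$. The map $d^1:\mathcal{A}\to\mathcal{M}$ is the linear map with $d^1(uv)=d^1(u)v+u\,d^1(v)$ and $d^1(x^i)=dx^i$. The right partial derivatives $D_k:\mathcal{A}\to\mathcal{A}$ are the linear maps defined by $d^1(v)=dx^kD_k(v)$; thus $D_k(x^i)=\delta^i_k$ and $D_k(uv)=D_k(u)v+\xi(u)^j_kD_j(v)$. Second order differentials. $\mathcal{M}^{(2)}$ is the free right $\mathcal{A}$-module with basis symbols $d^2x^1,\dots,d^2x^n$, made a bimodule by the same $\xi$: $u\,d^2x^j=d^2x^k\,\xi(u)^j_k$. Put $\mathcal{M}^{(1)}=\mathcal{M}$ and $d^1x^i=dx^i$ for basis symbols. Tensor algebra. $\mathcal{E}=\mathcal{M}^{(1)}\oplus\mathcal{M}^{(2)}$,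 where $\mathcal{M}^{(a)}$ has grade $a$, and $T_{\mathcal{A}}\mathcal{E}=\bigoplus_{p\ge0}\mathcal{E}^{\otimes_{\mathcal{A}} p}$ is its tensor algebra over $\mathcal{A}$, with total grading $T_{\mathcal{A}}\mathcal{E}=\bigoplus_{m\ge0}T^m$, $T^0=\mathcal{A}$, $T^m=\bigoplus_{a_1+\dots+a_p=m,\ a_i\in\{1,2\}}\mathcal{M}^{(a_1)}\otimes_{\mathcal{A}}\cdots\otimes_{\mathcal{A}}\mathcal{M}^{(a_p)}$. All $\otimes$ are over $\mathcal{A}$. Each element of $T^m$ is uniquely a sum of canonical terms $d^{a_1}x^{i_1}\otimes\cdots\otimes d^{a_p}x^{i_p}\,r_{i_1\dots i_p}$ with $a_i\in\{1,2\}$, $a_1+\dots+a_p=m$, $r_{i_1\dots i_p}\in\mathcal{A}$. The operator $d$. $d:T_{\mathcal{A}}\mathcal{E}\to T_{\mathcal{A}}\mathcal{E}$ is the grade-one linear map given on canonical terms by $$d(d^{a_1}x^{i_1}\otimes\cdots\otimes d^{a_p}x^{i_p}r)=\sum_{j=1}^p q^{a_1+\dots+a_{j-1}}\,d^{a_1}x^{i_1}\otimes\cdots\otimes d^{a_j+1}x^{i_j}\otimes\cdots\otimes d^{a_p}x^{i_p}r+q^{a_1+\dots+a_p}\,d^{a_1}x^{i_1}\otimes\cdots\otimes d^{a_p}x^{i_p}\otimes dx^sD_s(r),$$ with the convention $d^3x^i=0$ (a summand containing $d^3x^{i_j}$ is zero). For $p=0$: $d(r)=dx^sD_s(r)$.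 For $u\in\mathcal{A}$, $du=d(u)$, $d^2u=d(d(u))$, $d^3u=d(d(d(u)))$; explicitly $d^2u=d^2x^iD_i(u)+q\,dx^i\otimes dx^jD_j(D_i(u))$ and $d^3u=q[2]_q\,d^2x^i\otimes dx^jD_jD_i(u)+q^2dx^i\otimes d^2x^jD_jD_i(u)+dx^i\otimes dx^j\otimes dx^kD_kD_jD_i(u)$. The ideal. Put $\xi^{ij}_k=\xi(x^i)^j_k\in\mathcal{A}$. $I_q$ is the two-sided ideal of $T_{\mathcal{A}}\mathcal{E}$ generated by the following homogeneous elements, for all $i,j$ (and all $k$ in the sixth): $x^idx^j-dx^k\xi^{ij}_k$ and $x^id^2x^j-d^2x^k\xi^{ij}_k$ (both already zero in $T_{\mathcal{A}}\mathcal{E}$ by the bimodule structure); $dx^i\otimes dx^j-q\,dx^k\otimes d\xi^{ij}_k$; $dx^i\otimes d^2x^j-q^2\,d^2x^k\otimes d\xi^{ij}_k$; $d^2x^i\otimes dx^j+(1-q)\,d^2x^k\otimes d\xi^{ij}_k-q^2\,dx^k\otimes d^2\xi^{ij}_k$; $d^3\xi^{ij}_k$; $d^2x^i\otimes d^2x^j-q\,d^2x^k\otimes d^2\xi^{ij}_k$. $I_q^{(m)}=I_q\cap T^m$. Definition. A graded differential algebra with ternary differential is a pair $\{\Omega,d\}$ with $\Omega=\bigoplus_{m\ge0}\Omega^{(m)}$ a graded algebra with $\Omega^{(0)}=\mathcal{A}$ and $d:\Omega\to\Omega$ linear and homogeneous of grade one, such that $d(\omega\theta)=(d\omega)\theta+q^m\omega(d\theta)$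 for $\omega\in\Omega^{(m)}$, $\theta\in\Omega$, and $d^3=0$. *)

theory Defs
  imports
    Complex_Main
    "HOL-Library.Poly_Mapping"
    "HOL-Analysis.Finite_Cartesian_Product"
    "HOL-Algebra.Module"
    "HOL-Algebra.QuotRing"
begin



section \<open>The free algebra\<close>

text \<open>Words under concatenation are the free monoid, so the convolution product of
  \<^theory>\<open>HOL-Library.Poly_Mapping\<close> on finitely supported functions on words is the product of
  the free (monoid) algebra.\<close>

instantiation list :: (type) monoid_add
begin
definition zero_list :: "'a list" where "zero_list = []"
definition plus_list :: "'a list \<Rightarrow> 'a list \<Rightarrow> 'a list" where "plus_list = append"
instance by standard (simp_all add: zero_list_def plus_list_def)
end

type_synonym 'n falg = "'n list \<Rightarrow>\<^sub>0 complex"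

definition gen :: "'n \<Rightarrow> 'n falg" where
  "gen i = Poly_Mapping.single [i] 1"

definition cscale :: "complex \<Rightarrow> 'n falg \<Rightarrow> 'n falg" where
  "cscale c = Poly_Mapping.map ((*) c)"

text \<open>The matrix \<open>\<xi> u\<close> has the entry \<open>\<xi>(u)\<^sup>j\<^sub>k\<close> in row \<open>k\<close> (lower index) and column \<open>j\<close>
  (upper index), that is \<open>\<xi> u $ k $ j\<close>. With this layout the product convention
  \<open>\<xi>(uv)\<^sup>j\<^sub>l = \<xi>(u)\<^sup>k\<^sub>l \<xi>(v)\<^sup>j\<^sub>k\<close> is the usual matrix product.\<close>

definition mat_alg_hom :: "('n::finite falg \<Rightarrow> 'n falg ^ 'n ^ 'n) \<Rightarrow> bool" where
  "mat_alg_hom \<xi> \<longleftrightarrow>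
     (\<forall>u v. \<xi> (u + v) = \<xi> u + \<xi> v) \<and>
     (\<forall>c u. \<xi> (cscale c u) = (\<chi> k j. cscale c (\<xi> u $ k $ j))) \<and>
     \<xi> 1 = mat 1 \<and>
     (\<forall>u v. \<xi> (u * v) = \<xi> u ** \<xi> v)"

section \<open>First order calculus\<close>

text \<open>An element of the free right module \<open>\<M>\<close> is its coordinate vector: \<open>m\<close> stands for
  \<open>dx\<^sup>k (m $ k)\<close>. The right action is coordinatewise; since \<open>u dx\<^sup>j = dx\<^sup>k \<xi>(u)\<^sup>j\<^sub>k\<close>, the left
  action of \<open>u\<close> is multiplication of the coordinate vector by the matrix \<open>\<xi> u\<close>.\<close>

type_synonym 'n frmod = "'n falg ^ 'n"

definition ract :: "'n frmod \<Rightarrow> 'n falg \<Rightarrow> 'n::finite frmod" where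
  "ract m v = (\<chi> k. m $ k * v)"

definition lact :: "('n::finite falg \<Rightarrow> 'n falg ^ 'n ^ 'n) \<Rightarrow> 'n falg \<Rightarrow> 'n frmod \<Rightarrow> 'n frmod" where
  "lact \<xi> u m = \<xi> u *v m"

definition coord_differential ::
    "('n::finite falg \<Rightarrow> 'n falg ^ 'n ^ 'n) \<Rightarrow> ('n falg \<Rightarrow> 'n frmod) \<Rightarrow> bool" where
  "coord_differential \<xi> \<delta> \<longleftrightarrow>
     (\<forall>u v. \<delta> (u + v) = \<delta> u + \<delta> v) \<and>
     (\<forall>c u. \<delta> (cscale c u) = (\<chi> k. cscale c (\<delta> u $ k))) \<and>
     (\<forall>u v. \<delta> (u * v) = ract (\<delta> u) v + lact \<xi> u (\<delta> v)) \<and>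
     (\<forall>i. \<delta> (gen i) = axis i 1)"

text \<open>For an algebra homomorphism \<open>\<xi>\<close> there is exactly one such map; see
  \<open>ex1_coord_differential\<close> below.\<close>

definition d1 :: "('n::finite falg \<Rightarrow> 'n falg ^ 'n ^ 'n) \<Rightarrow> 'n falg \<Rightarrow> 'n frmod" where
  "d1 \<xi> = (THE \<delta>. coord_differential \<xi> \<delta>)"

definition pderiv_right ::
    "('n::finite falg \<Rightarrow> 'n falg ^ 'n ^ 'n) \<Rightarrow> 'n \<Rightarrow> 'n falg \<Rightarrow> 'n falg" where
  "pderiv_right \<xi> k v = d1 \<xi> v $ k"

section \<open>The tensor algebra\<close>

text \<open>The basis symbols of \<open>\<E> = \<M> \<oplus> \<M>\<^sup>(\<^sup>2\<^sup>)\<close>: \<open>Dx i\<close> is \<open>dx\<^sup>i\<close> and \<open>DDx i\<close> is \<open>d\<^sup>2x\<^sup>i\<close>.\<close>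

datatype 'n bsym = Dx (idx: 'n) | DDx (idx: 'n)

fun sym_grade :: "'n bsym \<Rightarrow> nat" where
  "sym_grade (Dx i) = 1"
| "sym_grade (DDx i) = 2"

definition word_grade :: "'n bsym list \<Rightarrow> nat" where
  "word_grade w = sum_list (map sym_grade w)"

text \<open>Elements of the tensor algebra are kept in canonical form: the coefficient of
  \<open>t\<close> at the word \<open>[b\<^sub>1, \<dots>, b\<^sub>p]\<close> is the element \<open>r\<close> of the free algebra in the canonical term
  \<open>b\<^sub>1 \<otimes> \<dots> \<otimes> b\<^sub>p r\<close>.

  Pitfall: the class product \<open>*\<close> on this type lets the basis symbols commute with their
  coefficients. It is used below only as \<open>single w 1 * t\<close> (put the symbols \<open>w\<close> in front of
  every term) and \<open>t * single [] r\<close> (multiply every coefficient by \<open>r\<close> from the right). The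
  product of the tensor algebra is \<open>tmul\<close>.\<close>

type_synonym 'n tens = "'n bsym list \<Rightarrow>\<^sub>0 'n falg"

text \<open>The left action of \<open>u\<close> on \<open>b\<^sub>1 \<otimes> \<dots> \<otimes> b\<^sub>p\<close>: by \<open>u d\<^sup>ax\<^sup>j = d\<^sup>ax\<^sup>k \<xi>(u)\<^sup>j\<^sub>k\<close> and balancedness
  of the tensor product, \<open>\<xi>(u)\<^sup>j\<^sub>k\<close> then acts on \<open>b\<^sub>2 \<otimes> \<dots> \<otimes> b\<^sub>p\<close>. The symbol
  \<open>map_bsym (\<lambda>_. k) b\<close> is \<open>b\<close> with its index replaced by \<open>k\<close>.\<close>

fun lact_word :: "('n::finite falg \<Rightarrow> 'n falg ^ 'n ^ 'n) \<Rightarrow> 'n falg \<Rightarrow> 'n bsym list \<Rightarrow> 'n tens" where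
  "lact_word \<xi> u [] = Poly_Mapping.single [] u"
| "lact_word \<xi> u (b # w) =
     (\<Sum>k\<in>UNIV. Poly_Mapping.single [map_bsym (\<lambda>_. k) b] 1 * lact_word \<xi> (\<xi> u $ k $ idx b) w)"

definition lact_tens :: "('n::finite falg \<Rightarrow> 'n falg ^ 'n ^ 'n) \<Rightarrow> 'n falg \<Rightarrow> 'n tens \<Rightarrow> 'n tens" where
  "lact_tens \<xi> u t =
     (\<Sum>w\<in>Poly_Mapping.keys t. lact_word \<xi> u w * Poly_Mapping.single [] (Poly_Mapping.lookup t w))"

definition tmul :: "('n::finite falg \<Rightarrow> 'n falg ^ 'n ^ 'n) \<Rightarrow> 'n tens \<Rightarrow> 'n tens \<Rightarrow> 'n tens" where
  "tmul \<xi> s t =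
     (\<Sum>w\<in>Poly_Mapping.keys s. Poly_Mapping.single w 1 * lact_tens \<xi> (Poly_Mapping.lookup s w) t)"

definition tscale :: "complex \<Rightarrow> 'n tens \<Rightarrow> 'n tens" where
  "tscale c = Poly_Mapping.map (cscale c)"

definition of_falg :: "'n falg \<Rightarrow> 'n tens" where
  "of_falg r = Poly_Mapping.single [] r"

definition of_sym :: "'n bsym \<Rightarrow> 'n tens" where
  "of_sym b = Poly_Mapping.single [b] 1"

definition tensor_alg ::
    "('n::finite falg \<Rightarrow> 'n falg ^ 'n ^ 'n) \<Rightarrow> (complex, 'n tens) module" where
  "tensor_alg \<xi> = \<lparr>carrier = UNIV, mult = tmul \<xi>, one = of_falg 1, zero = 0, add = (+), smult = tscale\<rparr>"

definition free_alg :: "(complex, 'n falg) module" where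
  "free_alg = \<lparr>carrier = UNIV, mult = (*), one = 1, zero = 0, add = (+), smult = cscale\<rparr>"

definition tgrade :: "nat \<Rightarrow> 'n tens set" where
  "tgrade m = {t. \<forall>w\<in>Poly_Mapping.keys t. word_grade w = m}"

section \<open>The first order calculus and the tensor algebra are as intended\<close>

lemma pm_additive_ext:
  fixes f g :: "('a \<Rightarrow>\<^sub>0 'b::ab_group_add) \<Rightarrow> 'c::ab_group_add"
  assumes f: "\<And>s t. f (s + t) = f s + f t" and g: "\<And>s t. g (s + t) = g s + g t"
    and eq: "\<And>k c. f (Poly_Mapping.single k c) = g (Poly_Mapping.single k c)"
  shows "f t = g t"
proof -
  have t: "t = (\<Sum>k\<in>Poly_Mapping.keys t. Poly_Mapping.single k (Poly_Mapping.lookup t k))"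
    by (rule poly_mapping_eqI)
      (auto simp: lookup_sum lookup_single when_def sum.delta in_keys_iff)
  have sum: "h (\<Sum>i\<in>I. x i) = (\<Sum>i\<in>I. h (x i))"
    if "\<And>s t. h (s + t) = h s + h t" for h :: "('a \<Rightarrow>\<^sub>0 'b) \<Rightarrow> 'c" and I :: "'a set" and x
  proof -
    have "h 0 = 0" using that[of 0 0] by simp
    then show ?thesis by (induction I rule: infinite_finite_induct) (simp_all add: that)
  qed
  show ?thesis
    by (subst (1 2) t) (simp only: sum[of f, OF f] sum[of g, OF g] eq)
qed

lemma keys_sum_add:
  fixes F :: "'k \<Rightarrow> 'b::monoid_add \<Rightarrow> 'c::comm_monoid_add"
  assumes "\<And>k x y. F k (x + y) = F k x + F k y" "\<And>k. F k 0 = 0"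
  shows "(\<Sum>k\<in>Poly_Mapping.keys (s + t). F k (Poly_Mapping.lookup (s + t) k)) =
    (\<Sum>k\<in>Poly_Mapping.keys s. F k (Poly_Mapping.lookup s k)) +
    (\<Sum>k\<in>Poly_Mapping.keys t. F k (Poly_Mapping.lookup t k))"
  using setsum_keys_plus_distrib[of F s t] assms by (simp add: lookup_add)

lemma additive_sum:
  fixes f :: "'b::ab_group_add \<Rightarrow> 'c::ab_group_add"
  assumes "\<And>s t. f (s + t) = f s + f t"
  shows "f (\<Sum>i\<in>I. h i) = (\<Sum>i\<in>I. f (h i))"
proof -
  have "f 0 = 0" using assms[of 0 0] by simp
  then show ?thesis by (induction I rule: infinite_finite_induct) (simp_all add: assms)
qed

lemma word_mult: "Poly_Mapping.single w a * Poly_Mapping.single v b = Poly_Mapping.single (w @ v) (a * b)"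
  by (simp add: mult_single plus_list_def)

lemma one_word: "Poly_Mapping.single [] 1 = 1"
  using single_one[where ?'a = "'a list"] unfolding zero_list_def .

lemma cscale_mult: "cscale c u = Poly_Mapping.single [] c * u"
proof (rule pm_additive_ext[of "cscale c" "\<lambda>u. Poly_Mapping.single [] c * u"])
  fix s t :: "'a falg"
  show "cscale c (s + t) = cscale c s + cscale c t"
    unfolding cscale_def by (rule poly_mapping_eqI) (auto simp: lookup_add map.rep_eq when_def distrib_left[symmetric])
  show "Poly_Mapping.single [] c * (s + t) = Poly_Mapping.single [] c * s + Poly_Mapping.single [] c * t"
    by (simp add: algebra_simps)
next
  fix k and a :: complex
  show "cscale c (Poly_Mapping.single k a) = Poly_Mapping.single [] c * Poly_Mapping.single k a"
    unfolding cscale_def word_mult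
    by (rule poly_mapping_eqI) (auto simp add: lookup_single map.rep_eq when_def)
qed

lemma cscale_central: "Poly_Mapping.single [] c * u = u * Poly_Mapping.single [] c" for c :: complex
  by (rule pm_additive_ext[of "\<lambda>u. Poly_Mapping.single [] c * u" "\<lambda>u. u * Poly_Mapping.single [] c"])
     (simp_all add: algebra_simps word_mult)

context
  fixes \<xi> :: "'n::finite falg \<Rightarrow> 'n falg ^ 'n ^ 'n"
  assumes hom: "mat_alg_hom \<xi>"
begin

lemma hom_add: "\<xi> (u + v) = \<xi> u + \<xi> v"
  and hom_scale: "\<xi> (cscale c u) = (\<chi> k j. cscale c (\<xi> u $ k $ j))"
  and hom_one: "\<xi> 1 = mat 1"
  and hom_mult: "\<xi> (u * v) = \<xi> u ** \<xi> v"
  using hom by (simp_all add: mat_alg_hom_def)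

lemma hom_zero: "\<xi> 0 = 0"
  using hom_add[of 0 0] by simp

lemma lact_word_add: "lact_word \<xi> (u + v) w = lact_word \<xi> u w + lact_word \<xi> v w"
  by (induction w arbitrary: u v) (simp_all add: single_add hom_add distrib_left sum.distrib)

lemma lact_word_zero: "lact_word \<xi> 0 w = 0"
  using lact_word_add[of 0 0] by simp

lemma lact_word_one: "lact_word \<xi> 1 w = Poly_Mapping.single w 1"
proof (induction w)
  case (Cons b w)
  have "lact_word \<xi> 1 (b # w) = (\<Sum>k\<in>UNIV. if k = idx b then Poly_Mapping.single (map_bsym (\<lambda>_. k) b # w) 1 else 0)"
    unfolding lact_word.simps
    by (intro sum.cong refl) (simp add: hom_one mat_def Cons lact_word_zero word_mult)
  also have "\<dots> = Poly_Mapping.single (map_bsym (\<lambda>_. idx b) b # w) 1" by simp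
  also have "map_bsym (\<lambda>_. idx b) b = b" by (cases b) auto
  finally show ?case .
qed simp

lemma lact_tens_add: "lact_tens \<xi> u (s + t) = lact_tens \<xi> u s + lact_tens \<xi> u t"
  unfolding lact_tens_def by (rule keys_sum_add) (simp_all add: single_add distrib_left)

lemma lact_tens_single: "lact_tens \<xi> u (Poly_Mapping.single w r) = lact_word \<xi> u w * Poly_Mapping.single [] r"
  by (simp add: lact_tens_def)

lemma lact_tens_add_left: "lact_tens \<xi> (u + v) t = lact_tens \<xi> u t + lact_tens \<xi> v t"
  by (simp add: lact_tens_def lact_word_add distrib_right sum.distrib)

lemma lact_tens_zero: "lact_tens \<xi> 0 t = 0"
  using lact_tens_add_left[of 0 0] by simp

lemma lact_tens_one: "lact_tens \<xi> 1 t = t"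
  by (rule pm_additive_ext[of "lact_tens \<xi> 1" "\<lambda>t. t"])
    (simp_all add: lact_tens_add lact_tens_single lact_word_one word_mult)

lemma lact_tens_right: "lact_tens \<xi> u (t * Poly_Mapping.single [] r) = lact_tens \<xi> u t * Poly_Mapping.single [] r"
  by (rule pm_additive_ext[of "\<lambda>t. lact_tens \<xi> u (t * Poly_Mapping.single [] r)"])
    (simp_all add: lact_tens_add lact_tens_single word_mult distrib_right mult.assoc)

lemma lact_tens_Cons: "lact_tens \<xi> u (Poly_Mapping.single [b] 1 * t) =
   (\<Sum>k\<in>UNIV. Poly_Mapping.single [map_bsym (\<lambda>_. k) b] 1 * lact_tens \<xi> (\<xi> u $ k $ idx b) t)"
  by (rule pm_additive_ext[of "\<lambda>t. lact_tens \<xi> u (Poly_Mapping.single [b] 1 * t)"])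
    (simp_all add: lact_tens_add lact_tens_single word_mult distrib_left sum.distrib sum_distrib_right mult.assoc)

lemma lact_tens_word: "lact_tens \<xi> u (lact_word \<xi> v w) = lact_word \<xi> (u * v) w"
proof (induction w arbitrary: u v)
  case Nil
  then show ?case by (simp add: lact_tens_single word_mult)
next
  case (Cons b w)
  let ?P = "\<lambda>k. Poly_Mapping.single [map_bsym (\<lambda>_. k) b] (1::'n falg)"
  have m: "map_bsym (\<lambda>_. l) (map_bsym (\<lambda>_. k) b) = map_bsym (\<lambda>_. l) b" "idx (map_bsym (\<lambda>_. k) b) = k"
    for l k :: 'n by (cases b; simp)+
  have "lact_tens \<xi> u (lact_word \<xi> v (b # w)) =
      (\<Sum>k\<in>UNIV. \<Sum>l\<in>UNIV. ?P l * lact_word \<xi> (\<xi> u $ l $ k * \<xi> v $ k $ idx b) w)"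
    by (simp add: additive_sum[of "lact_tens \<xi> u", OF lact_tens_add] lact_tens_Cons m Cons)
  also have "\<dots> = (\<Sum>l\<in>UNIV. ?P l * (\<Sum>k\<in>UNIV. lact_word \<xi> (\<xi> u $ l $ k * \<xi> v $ k $ idx b) w))"
    by (subst sum.swap) (simp add: sum_distrib_left)
  also have "\<dots> = (\<Sum>l\<in>UNIV. ?P l * lact_word \<xi> (\<Sum>k\<in>UNIV. \<xi> u $ l $ k * \<xi> v $ k $ idx b) w)"
    by (simp add: additive_sum[of "\<lambda>u. lact_word \<xi> u w", OF lact_word_add])
  also have "\<dots> = lact_word \<xi> (u * v) (b # w)"
    by (simp add: hom_mult matrix_matrix_mult_def)
  finally show ?case .
qed

lemma lact_tens_mult: "lact_tens \<xi> u (lact_tens \<xi> v t) = lact_tens \<xi> (u * v) t"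
  by (rule pm_additive_ext[of "\<lambda>t. lact_tens \<xi> u (lact_tens \<xi> v t)"])
    (simp_all add: lact_tens_add lact_tens_single lact_tens_right lact_tens_word)

lemma tmul_add_left: "tmul \<xi> (s + s') t = tmul \<xi> s t + tmul \<xi> s' t"
  unfolding tmul_def
  by (rule keys_sum_add[of "\<lambda>w r. Poly_Mapping.single w 1 * lact_tens \<xi> r t"])
    (simp_all add: lact_tens_add_left distrib_left lact_tens_zero)

lemma tmul_add_right: "tmul \<xi> s (t + t') = tmul \<xi> s t + tmul \<xi> s t'"
  by (simp add: tmul_def lact_tens_add distrib_left sum.distrib)

lemma tmul_single: "tmul \<xi> (Poly_Mapping.single w r) t = Poly_Mapping.single w 1 * lact_tens \<xi> r t"
  by (simp add: tmul_def lact_tens_zero)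

lemma tmul_word: "tmul \<xi> (Poly_Mapping.single w 1 * s) t = Poly_Mapping.single w 1 * tmul \<xi> s t"
  by (rule pm_additive_ext[of "\<lambda>s. tmul \<xi> (Poly_Mapping.single w 1 * s) t"])
    (simp_all add: tmul_add_left tmul_single word_mult distrib_left mult.assoc[symmetric])

lemma tmul_lact_word: "tmul \<xi> (lact_word \<xi> r w * Poly_Mapping.single [] a) t =
  lact_tens \<xi> r (Poly_Mapping.single w 1 * lact_tens \<xi> a t)"
proof (induction w arbitrary: r)
  case Nil
  then show ?case by (simp add: word_mult tmul_single lact_tens_mult one_word)
next
  case (Cons b w)
  have "Poly_Mapping.single (b # w) 1 = Poly_Mapping.single [b] (1::'n falg) * Poly_Mapping.single w 1"
    by (simp add: word_mult)
  then have "lact_tens \<xi> r (Poly_Mapping.single (b # w) 1 * lact_tens \<xi> a t) =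
     lact_tens \<xi> r (Poly_Mapping.single [b] 1 * (Poly_Mapping.single w 1 * lact_tens \<xi> a t))"
    by (simp add: mult.assoc)
  also have "\<dots> = tmul \<xi> (lact_word \<xi> r (b # w) * Poly_Mapping.single [] a) t"
    by (simp add: lact_tens_Cons Cons[symmetric] sum_distrib_right mult.assoc
         additive_sum[of "\<lambda>s. tmul \<xi> s t", OF tmul_add_left] tmul_word)
  finally show ?case by simp
qed

lemma tmul_lact: "tmul \<xi> (lact_tens \<xi> r s) t = lact_tens \<xi> r (tmul \<xi> s t)"
  by (rule pm_additive_ext[of "\<lambda>s. tmul \<xi> (lact_tens \<xi> r s) t"])
    (simp_all add: lact_tens_add tmul_add_left tmul_single lact_tens_single tmul_lact_word)

lemma tmul_assoc: "tmul \<xi> (tmul \<xi> s t) u = tmul \<xi> s (tmul \<xi> t u)"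
  by (rule pm_additive_ext[of "\<lambda>s. tmul \<xi> (tmul \<xi> s t) u"])
    (simp_all add: tmul_add_left tmul_single tmul_word tmul_lact)

lemma tmul_one_left: "tmul \<xi> (of_falg 1) t = t"
  by (simp only: of_falg_def tmul_single lact_tens_one) (simp add: one_word)

lemma tmul_one_right: "tmul \<xi> t (of_falg 1) = t"
  by (rule pm_additive_ext[of "\<lambda>t. tmul \<xi> t (of_falg 1)"])
    (simp_all add: tmul_add_left tmul_single of_falg_def lact_tens_single word_mult)

lemma ring_tensor_alg: "ring (tensor_alg \<xi>)"
proof (rule ringI)
  show "abelian_group (tensor_alg \<xi>)"
    by (rule abelian_groupI) (auto simp: tensor_alg_def add.assoc add.commute intro: exI[of _ "- _"] left_minus)
  show "monoid (tensor_alg \<xi>)"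
    by (rule monoidI) (auto simp: tensor_alg_def tmul_assoc tmul_one_left tmul_one_right)
qed (auto simp: tensor_alg_def tmul_add_left tmul_add_right)

lemma left_act_sym: "tmul \<xi> (of_falg u) (of_sym b) =
    (\<Sum>k\<in>UNIV. tmul \<xi> (of_sym (map_bsym (\<lambda>_. k) b)) (of_falg (\<xi> u $ k $ idx b)))"
  by (simp add: of_falg_def of_sym_def tmul_single lact_tens_single lact_tens_one one_word)

lemma canonical_term:
  "Poly_Mapping.single w r = foldr (\<lambda>b t. tmul \<xi> (of_sym b) t) w (of_falg r)"
proof (induction w)
  case (Cons b w)
  have "foldr (\<lambda>b t. tmul \<xi> (of_sym b) t) (b # w) (of_falg r) = tmul \<xi> (of_sym b) (Poly_Mapping.single w r)"
    by (simp only: foldr.simps o_apply Cons)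
  also have "\<dots> = Poly_Mapping.single (b # w) r"
    by (simp add: of_sym_def tmul_single lact_tens_one word_mult)
  finally show ?case by simp
qed (simp add: of_falg_def)

text \<open>The universal property: \<open>tensor_alg \<xi>\<close> is the tensor ring of the bimodule \<open>\<E>\<close>. A ring
  homomorphism \<open>f\<close> on the free algebra together with a bimodule map on \<open>\<E>\<close>, given by its values
  \<open>g\<close> on the right basis and hence subject to \<open>fg\<close>, extends uniquely to a ring homomorphism.\<close>

theorem tensor_alg_universal:
  fixes f :: "'n falg \<Rightarrow> 'b::ring_1" and g :: "'n bsym \<Rightarrow> 'b"
  assumes f_add: "\<And>u v. f (u + v) = f u + f v"
    and f_mult: "\<And>u v. f (u * v) = f u * f v"
    and f_one: "f 1 = 1"
    and fg: "\<And>u b. f u * g b = (\<Sum>k\<in>UNIV. g (map_bsym (\<lambda>_. k) b) * f (\<xi> u $ k $ idx b))"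
  shows "\<exists>!F. (\<forall>s t. F (s + t) = F s + F t) \<and> (\<forall>s t. F (tmul \<xi> s t) = F s * F t) \<and>
    (\<forall>u. F (of_falg u) = f u) \<and> (\<forall>b. F (of_sym b) = g b)"
proof -
  have f0: "f 0 = 0" using f_add[of 0 0] by simp
  define F where "F t = (\<Sum>w\<in>Poly_Mapping.keys t. prod_list (map g w) * f (Poly_Mapping.lookup t w))" for t
  have F_add: "F (s + t) = F s + F t" for s t
    unfolding F_def by (rule keys_sum_add) (simp_all add: f_add f0 distrib_left)
  have F_single: "F (Poly_Mapping.single w r) = prod_list (map g w) * f r" for w r
    by (simp add: F_def f0)
  have F_word: "F (Poly_Mapping.single w 1 * t) = prod_list (map g w) * F t" for w t
    by (rule pm_additive_ext[of "\<lambda>t. F (Poly_Mapping.single w 1 * t)"])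
      (simp_all add: F_add F_single word_mult distrib_left mult.assoc)
  have F_right: "F (t * Poly_Mapping.single [] r) = F t * f r" for t r
    by (rule pm_additive_ext[of "\<lambda>t. F (t * Poly_Mapping.single [] r)"])
      (simp_all add: F_add F_single word_mult distrib_right mult.assoc f_mult)
  have F_lact_word: "F (lact_word \<xi> u w) = f u * prod_list (map g w)" for u w
  proof (induction w arbitrary: u)
    case (Cons b w)
    have "F (lact_word \<xi> u (b # w)) =
       (\<Sum>k\<in>UNIV. g (map_bsym (\<lambda>_. k) b) * f (\<xi> u $ k $ idx b)) * prod_list (map g w)"
      by (simp add: additive_sum[of F, OF F_add] F_word Cons sum_distrib_right mult.assoc)
    then show ?case by (simp add: fg[symmetric] mult.assoc)
  qed (simp add: F_single)
  have F_lact: "F (lact_tens \<xi> u t) = f u * F t" for u t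
    by (rule pm_additive_ext[of "\<lambda>t. F (lact_tens \<xi> u t)"])
      (simp_all add: lact_tens_add F_add lact_tens_single F_right F_lact_word F_single distrib_left mult.assoc)
  have F_mult: "F (tmul \<xi> s t) = F s * F t" for s t
    by (rule pm_additive_ext[of "\<lambda>s. F (tmul \<xi> s t)"])
      (simp_all add: tmul_add_left F_add tmul_single F_word F_lact F_single distrib_right mult.assoc)
  show ?thesis
  proof (rule ex1I[of _ F])
    show "(\<forall>s t. F (s + t) = F s + F t) \<and> (\<forall>s t. F (tmul \<xi> s t) = F s * F t) \<and>
      (\<forall>u. F (of_falg u) = f u) \<and> (\<forall>b. F (of_sym b) = g b)"
      by (simp add: F_add F_mult of_falg_def of_sym_def F_single f_one)
  next
    fix H
    assume H: "(\<forall>s t. H (s + t) = H s + H t) \<and> (\<forall>s t. H (tmul \<xi> s t) = H s * H t) \<and>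
      (\<forall>u. H (of_falg u) = f u) \<and> (\<forall>b. H (of_sym b) = g b)"
    have *: "H (Poly_Mapping.single w r) = prod_list (map g w) * f r" for w r
    proof (induction w)
      case Nil
      then show ?case using H by (simp add: of_falg_def)
    next
      case (Cons b w)
      have "Poly_Mapping.single (b # w) r = tmul \<xi> (of_sym b) (Poly_Mapping.single w r)"
        by (simp add: of_sym_def tmul_single lact_tens_one word_mult)
      then show ?case using H Cons by (simp add: mult.assoc)
    qed
    show "H = F"
      by (rule ext, rule pm_additive_ext[of H F]) (use H in \<open>simp_all add: F_add * F_single\<close>)
  qed
qed

lemma lact_add: "lact \<xi> (u + v) m = lact \<xi> u m + lact \<xi> v m"
  by (simp add: lact_def hom_add vec_eq_iff matrix_vector_mult_def distrib_right sum.distrib)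

lemma lact_add_right: "lact \<xi> u (m + m') = lact \<xi> u m + lact \<xi> u m'"
  by (simp add: lact_def matrix_vector_right_distrib)

lemma lact_mult: "lact \<xi> (u * v) m = lact \<xi> u (lact \<xi> v m)"
  by (simp add: lact_def hom_mult matrix_vector_mul_assoc)

lemma lact_zero: "lact \<xi> u 0 = 0"
  by (simp add: lact_def)

lemma lact_one: "lact \<xi> 1 m = m"
  by (simp add: lact_def hom_one)

lemma lact_ract: "lact \<xi> u (ract m v) = ract (lact \<xi> u m) v"
  by (simp add: lact_def ract_def vec_eq_iff matrix_vector_mult_def sum_distrib_right mult.assoc)

lemma lact_scalar: "lact \<xi> (Poly_Mapping.single [] c) m = ract m (Poly_Mapping.single [] c)"
proof -
  have *: "Poly_Mapping.single [] c = cscale c (1::'n falg)" by (simp add: cscale_mult)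
  have "\<xi> (Poly_Mapping.single [] c) $ k $ j = (if k = j then Poly_Mapping.single [] c else 0)" for k j
    by (simp add: * hom_scale hom_one mat_def) (simp add: cscale_mult)
  then show ?thesis
    by (simp add: lact_def ract_def vec_eq_iff matrix_vector_mult_def if_distrib[of "\<lambda>x. x * _"]
          cscale_central cong: if_cong)
qed



lemma ract_add: "ract (m + m') v = ract m v + ract m' v"
  and ract_add_right: "ract m (v + v') = ract m v + ract m v'"
  and ract_ract: "ract (ract m u) v = ract m (u * v)"
  and ract_one: "ract m 1 = m"
  and ract_zero: "ract m 0 = 0"
  for m :: "'n frmod"
  by (simp_all add: ract_def vec_eq_iff distrib_left distrib_right mult.assoc)

primrec word_diff :: "'n list \<Rightarrow> 'n frmod" where
  "word_diff [] = 0"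
| "word_diff (i # w) = ract (axis i 1) (Poly_Mapping.single w 1) + lact \<xi> (gen i) (word_diff w)"

lemma word_diff_append: "word_diff (w @ w') =
    ract (word_diff w) (Poly_Mapping.single w' 1) + lact \<xi> (Poly_Mapping.single w 1) (word_diff w')"
proof (induction w)
  case Nil
  then show ?case by (simp add: one_word lact_one) (simp add: ract_def vec_eq_iff)
next
  case (Cons i w)
  have "Poly_Mapping.single (i # w) 1 = gen i * Poly_Mapping.single w 1"
    by (simp add: gen_def word_mult)
  then show ?case
    by (simp add: Cons lact_add_right lact_mult lact_ract ract_add ract_ract word_mult add.assoc)
qed

definition exdiff :: "'n falg \<Rightarrow> 'n frmod" where
  "exdiff u = (\<Sum>w\<in>Poly_Mapping.keys u. ract (word_diff w) (Poly_Mapping.single [] (Poly_Mapping.lookup u w)))"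

lemma exdiff_add: "exdiff (u + v) = exdiff u + exdiff v"
  unfolding exdiff_def by (rule keys_sum_add) (simp_all add: single_add ract_add_right ract_zero)

lemma exdiff_single: "exdiff (Poly_Mapping.single w c) = ract (word_diff w) (Poly_Mapping.single [] c)"
  by (simp add: exdiff_def ract_zero)

lemma exdiff_mult: "exdiff (u * v) = ract (exdiff u) v + lact \<xi> u (exdiff v)"
proof (rule pm_additive_ext[of "\<lambda>u. exdiff (u * v)"])
  fix w and a :: complex
  show "exdiff (Poly_Mapping.single w a * v) =
     ract (exdiff (Poly_Mapping.single w a)) v + lact \<xi> (Poly_Mapping.single w a) (exdiff v)"
  proof (rule pm_additive_ext[of "\<lambda>v. exdiff (Poly_Mapping.single w a * v)"])
    fix w' and b :: complex
    have a: "lact \<xi> (Poly_Mapping.single w a) m =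
        ract (lact \<xi> (Poly_Mapping.single w 1) m) (Poly_Mapping.single [] a)" for m
      using lact_mult[of "Poly_Mapping.single w 1" "Poly_Mapping.single [] a" m]
      by (simp add: word_mult lact_scalar lact_ract)
    show "exdiff (Poly_Mapping.single w a * Poly_Mapping.single w' b) =
      ract (exdiff (Poly_Mapping.single w a)) (Poly_Mapping.single w' b) +
      lact \<xi> (Poly_Mapping.single w a) (exdiff (Poly_Mapping.single w' b))"
      by (subst a) (simp add: word_mult exdiff_single word_diff_append ract_add ract_ract lact_ract mult.commute)
  qed (simp_all add: exdiff_add lact_add_right ract_add_right distrib_left)
qed (simp_all add: exdiff_add lact_add ract_add distrib_right)

lemma scale_ract: "(\<chi> k. cscale c (m $ k)) = ract m (Poly_Mapping.single [] c)" for m :: "'n frmod"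
  by (simp add: ract_def cscale_mult cscale_central)

lemma exdiff_coord_differential: "coord_differential \<xi> exdiff"
  unfolding coord_differential_def
proof (intro conjI allI)
  fix c u
  show "exdiff (cscale c u) = (\<chi> k. cscale c (exdiff u $ k))"
    by (simp add: scale_ract cscale_mult exdiff_mult exdiff_single lact_scalar) (simp add: ract_def vec_eq_iff cscale_central)
qed (simp_all add: exdiff_add exdiff_mult gen_def exdiff_single one_word ract_one lact_zero)

lemma coord_differential_unique:
  assumes "coord_differential \<xi> \<delta>"
  shows "\<delta> = exdiff"
proof
  fix u
  have add: "\<delta> (u + v) = \<delta> u + \<delta> v" and scale: "\<delta> (cscale c u) = ract (\<delta> u) (Poly_Mapping.single [] c)"
    and mult: "\<delta> (u * v) = ract (\<delta> u) v + lact \<xi> u (\<delta> v)" and gen: "\<delta> (gen i) = axis i 1" for u v c i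
    using assms by (simp_all add: coord_differential_def scale_ract)
  have "\<delta> 1 = 0"
    using mult[of 1 1] by (simp add: ract_one lact_one)
  then have word: "\<delta> (Poly_Mapping.single w 1) = word_diff w" for w
  proof (induction w)
    case (Cons i w)
    have "Poly_Mapping.single (i # w) 1 = gen i * Poly_Mapping.single w 1"
      by (simp add: gen_def word_mult)
    then show ?case by (simp add: mult gen Cons)
  qed (simp add: one_word)
  show "\<delta> u = exdiff u"
  proof (rule pm_additive_ext[of \<delta>])
    fix w :: "'n list" and c :: complex
    have "cscale c (Poly_Mapping.single w 1) = Poly_Mapping.single w c"
      by (simp add: cscale_mult word_mult)
    then show "\<delta> (Poly_Mapping.single w c) = exdiff (Poly_Mapping.single w c)"
      using scale[of c "Poly_Mapping.single w 1"] by (simp add: word exdiff_single)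
  qed (simp_all add: add exdiff_add)
qed

theorem ex1_coord_differential: "\<exists>!\<delta>. coord_differential \<xi> \<delta>"
  using exdiff_coord_differential coord_differential_unique by blast

corollary d1_coord_differential: "coord_differential \<xi> (d1 \<xi>)"
  unfolding d1_def by (rule theI'[OF ex1_coord_differential])

end

section \<open>The operator d\<close>

definition qroot :: complex where
  "qroot = exp (2 * of_real pi * \<i> / 3)"

text \<open>\<open>raise_at j w r\<close> is the canonical term \<open>w r\<close> with the \<open>j\<close>-th symbol (counted from 0)
  replaced by its differential, where \<open>d\<^sup>3x\<^sup>i = 0\<close>.\<close>

definition raise_at :: "nat \<Rightarrow> 'n bsym list \<Rightarrow> 'n falg \<Rightarrow> 'n tens" where
  "raise_at j w r = (case w ! j of Dx i \<Rightarrow> Poly_Mapping.single (w[j := DDx i]) r | DDx i \<Rightarrow> 0)"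

definition tdiff_term ::
    "('n::finite falg \<Rightarrow> 'n falg ^ 'n ^ 'n) \<Rightarrow> 'n bsym list \<Rightarrow> 'n falg \<Rightarrow> 'n tens" where
  "tdiff_term \<xi> w r =
     (\<Sum>j<length w. tscale (qroot ^ word_grade (take j w)) (raise_at j w r)) +
     tscale (qroot ^ word_grade w) (\<Sum>s\<in>UNIV. Poly_Mapping.single (w @ [Dx s]) (pderiv_right \<xi> s r))"

definition tdiff :: "('n::finite falg \<Rightarrow> 'n falg ^ 'n ^ 'n) \<Rightarrow> 'n tens \<Rightarrow> 'n tens" where
  "tdiff \<xi> t = (\<Sum>w\<in>Poly_Mapping.keys t. tdiff_term \<xi> w (Poly_Mapping.lookup t w))"

section \<open>The ideal and the quotient\<close>

context
  fixes \<xi> :: "'n::finite falg \<Rightarrow> 'n falg ^ 'n ^ 'n"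
begin

definition xi_coord :: "'n \<Rightarrow> 'n \<Rightarrow> 'n \<Rightarrow> 'n tens" where
  "xi_coord i j k = of_falg (\<xi> (gen i) $ k $ j)"

definition ideal_gens :: "'n tens set" where
  "ideal_gens =
     (let X = (\<lambda>i. of_falg (gen i)); dX = (\<lambda>i. of_sym (Dx i)); ddX = (\<lambda>i. of_sym (DDx i));
          D = tdiff \<xi>; T = tmul \<xi>
      in
        {T (X i) (dX j) - (\<Sum>k\<in>UNIV. T (dX k) (xi_coord i j k)) | i j. True} \<union>
        {T (X i) (ddX j) - (\<Sum>k\<in>UNIV. T (ddX k) (xi_coord i j k)) | i j. True} \<union>
        {T (dX i) (dX j) - tscale qroot (\<Sum>k\<in>UNIV. T (dX k) (D (xi_coord i j k))) | i j. True} \<union>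
        {T (dX i) (ddX j) - tscale (qroot\<^sup>2) (\<Sum>k\<in>UNIV. T (ddX k) (D (xi_coord i j k))) | i j. True} \<union>
        {T (ddX i) (dX j) + tscale (1 - qroot) (\<Sum>k\<in>UNIV. T (ddX k) (D (xi_coord i j k)))
           - tscale (qroot\<^sup>2) (\<Sum>k\<in>UNIV. T (dX k) (D (D (xi_coord i j k)))) | i j. True} \<union>
        {D (D (D (xi_coord i j k))) | i j k. True} \<union>
        {T (ddX i) (ddX j) - tscale qroot (\<Sum>k\<in>UNIV. T (ddX k) (D (D (xi_coord i j k)))) | i j. True})"

definition Iq :: "'n tens set" where
  "Iq = Idl\<^bsub>tensor_alg \<xi>\<^esub> ideal_gens"

end

definition quot_alg :: "('c, 'a) module \<Rightarrow> 'a set \<Rightarrow> ('c, 'a set) module" where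
  "quot_alg R I =
     ring.extend (R Quot I) (module.fields (\<lambda>c X. \<Union>x\<in>X. I +>\<^bsub>R\<^esub> (c \<odot>\<^bsub>R\<^esub> x)))"

definition Omega :: "('n::finite falg \<Rightarrow> 'n falg ^ 'n ^ 'n) \<Rightarrow> (complex, 'n tens set) module" where
  "Omega \<xi> = quot_alg (tensor_alg \<xi>) (Iq \<xi>)"

definition Omega_class :: "('n::finite falg \<Rightarrow> 'n falg ^ 'n ^ 'n) \<Rightarrow> 'n tens \<Rightarrow> 'n tens set" where
  "Omega_class \<xi> t = Iq \<xi> +>\<^bsub>tensor_alg \<xi>\<^esub> t"

text \<open>\<open>T\<^sup>m / I\<^sub>q\<^sup>(\<^sup>m\<^sup>)\<close>, realised inside the quotient as the image of \<open>T\<^sup>m\<close>.\<close>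

definition Omega_grade :: "('n::finite falg \<Rightarrow> 'n falg ^ 'n ^ 'n) \<Rightarrow> nat \<Rightarrow> 'n tens set set" where
  "Omega_grade \<xi> m = Omega_class \<xi> ` tgrade m"

section \<open>Graded differential algebras with ternary differential\<close>

definition complex_ring :: "complex ring" where
  "complex_ring = \<lparr>carrier = UNIV, mult = (*), one = 1, zero = 0, add = (+)\<rparr>"

locale complex_algebra = module complex_ring R + ring R
    for R :: "(complex, 'a) module" (structure) +
  assumes smult_mult_left:
      "\<lbrakk>x \<in> carrier R; y \<in> carrier R\<rbrakk> \<Longrightarrow> (c \<odot> x) \<otimes> y = c \<odot> (x \<otimes> y)"
    and smult_mult_right:
      "\<lbrakk>x \<in> carrier R; y \<in> carrier R\<rbrakk> \<Longrightarrow> x \<otimes> (c \<odot> y) = c \<odot> (x \<otimes> y)"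

locale graded_complex_algebra = complex_algebra R
    for R :: "(complex, 'a) module" (structure) and G :: "nat \<Rightarrow> 'a set" +
  assumes grade_submodule: "submodule (G m) complex_ring R"
    and grade_direct_sum:
      "x \<in> carrier R \<Longrightarrow>
         \<exists>!f. (\<forall>m. f m \<in> G m) \<and> finite {m. f m \<noteq> \<zero>} \<and> x = (\<Oplus>m\<in>{m. f m \<noteq> \<zero>}. f m)"
    and grade_one: "\<one> \<in> G 0"
    and grade_mult: "\<lbrakk>x \<in> G m; y \<in> G k\<rbrakk> \<Longrightarrow> x \<otimes> y \<in> G (m + k)"

text \<open>The condition \<open>\<Omega>\<^sup>(\<^sup>0\<^sup>) = \<A>\<close> is an identification along the algebra isomorphism \<open>\<iota>\<close>.\<close>

locale ternary_gda = graded_complex_algebra R G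
    for R :: "(complex, 'a) module" (structure) and G :: "nat \<Rightarrow> 'a set" +
  fixes A :: "(complex, 'b) module" and \<iota> :: "'b \<Rightarrow> 'a" and D :: "'a \<Rightarrow> 'a"
  assumes grade_zero_hom: "\<iota> \<in> ring_hom A R"
    and grade_zero_smult: "a \<in> carrier A \<Longrightarrow> \<iota> (c \<odot>\<^bsub>A\<^esub> a) = c \<odot> \<iota> a"
    and grade_zero_bij: "bij_betw \<iota> (carrier A) (G 0)"
    and D_closed: "x \<in> carrier R \<Longrightarrow> D x \<in> carrier R"
    and D_add: "\<lbrakk>x \<in> carrier R; y \<in> carrier R\<rbrakk> \<Longrightarrow> D (x \<oplus> y) = D x \<oplus> D y"
    and D_smult: "x \<in> carrier R \<Longrightarrow> D (c \<odot> x) = c \<odot> D x"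
    and D_grade: "x \<in> G m \<Longrightarrow> D x \<in> G (m + 1)"
    and D_leibniz:
      "\<lbrakk>x \<in> G m; y \<in> carrier R\<rbrakk> \<Longrightarrow> D (x \<otimes> y) = D x \<otimes> y \<oplus> (qroot ^ m) \<odot> (x \<otimes> D y)"
    and D_cubed: "x \<in> carrier R \<Longrightarrow> D (D (D x)) = \<zero>"

end

(*
  On the tensor algebra, d satisfies the Leibniz rule exactly for a basis symbol on the left, and
  only up to the relations  dx^i dx^j = q dx^k d xi^ij_k  and  dx^i d^2x^j = q^2 d^2x^k d xi^ij_k
  for an algebra element on the left. These two families generate an ideal J with d J contained in
  I_q: modulo J their derivatives are the fifth and the last family of generators. Hence d^3 is
  a derivation of A modulo I_q (the middle terms carry the factor 1 + q + q^2) which kills the generators x^i,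
  so d^3 u lies in I_q for every u in A. Since d^3 (w u) = w d^3 u for a word w in the basis
  symbols, d^3 maps the whole tensor algebra into I_q. This takes care of the derivatives
  of the remaining generators, so d I_q is contained in I_q.
*)

theory Submission
  imports Defs
begin

section \<open>Complex scalars\<close>

text \<open>\<open>tdiff\<close> sees only canonical terms, with the coefficient on the right. In a
  product a b of an algebra element and a symbol, a must first cross b and turns into a column of
  entries of \<xi>(a); these are differentiated behind the symbols and pick up a power of q. The
  Leibniz rule asks for (d a) b in front instead, and the bimodule structure does not in general
  identify the two. The difference \<open>leib a b\<close> is, however, a twisted derivation in a
  because \<xi> is multiplicative, so killing it at the generators x^i kills it everywhere. The
  obstacle is a circularity: invariance of the whole ideal leans on third derivatives, while the
  third derivative of a product contains Leibniz defects that have been differentiated once more. It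
  is broken because the defects at the x^i can be differentiated by hand without meeting a third
  derivative of an algebra element.\<close>

lemma tscale_eq_times: "tscale c t = Poly_Mapping.single [] (Poly_Mapping.single [] c) * t"
proof (rule pm_additive_ext[of "tscale c"])
  fix s t :: "'a tens"
  show "tscale c (s + t) = tscale c s + tscale c t"
    unfolding tscale_def
    by (rule poly_mapping_eqI)
      (auto simp: lookup_add map.rep_eq when_def cscale_mult distrib_left[symmetric])
next
  fix w :: "'a bsym list" and r
  show "tscale c (Poly_Mapping.single w r) =
      Poly_Mapping.single [] (Poly_Mapping.single [] c) * Poly_Mapping.single w r"
    unfolding tscale_def word_mult
    by (rule poly_mapping_eqI) (auto simp: lookup_single map.rep_eq when_def cscale_mult)
qed (simp add: distrib_left)

text \<open>For the class product, scaling is left multiplication by an element, so all these laws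
  are ring laws.\<close>

lemma tscale_add: "tscale c (s + t) = tscale c s + tscale c t"
  and tscale_diff: "tscale c (s - t) = tscale c s - tscale c t"
  and tscale_minus: "tscale c (- t) = - tscale c t"
  and tscale_zero: "tscale c 0 = 0"
  and tscale_add_left: "tscale (a + b) t = tscale a t + tscale b t"
  and tscale_diff_left: "tscale (a - b) t = tscale a t - tscale b t"
  and tscale_minus_left: "tscale (- a) t = - tscale a t"
  and tscale_one: "tscale 1 t = t"
  and tscale_tscale: "tscale a (tscale b t) = tscale (a * b) t"
  and tscale_sum: "tscale c (\<Sum>i\<in>S. f i) = (\<Sum>i\<in>S. tscale c (f i))"
  by (simp_all add: tscale_eq_times algebra_simps single_add single_diff single_uminus one_word
      word_mult sum_distrib_left mult.assoc[symmetric])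

lemma tscale_single: "tscale c (Poly_Mapping.single w r) = Poly_Mapping.single w (cscale c r)"
  by (simp add: tscale_eq_times word_mult cscale_mult)

section \<open>Induction over canonical terms and over the free algebra\<close>

lemma pm_eq_sum_single: "t = (\<Sum>k\<in>Poly_Mapping.keys t. Poly_Mapping.single k (Poly_Mapping.lookup t k))"
  by (rule poly_mapping_eqI) (auto simp: lookup_sum lookup_single when_def in_keys_iff)

lemma pm_additive_induct [case_names single add]:
  fixes P :: "('a \<Rightarrow>\<^sub>0 'b::ab_group_add) \<Rightarrow> bool"
  assumes single: "\<And>w r. P (Poly_Mapping.single w r)"
    and add: "\<And>s t. P s \<Longrightarrow> P t \<Longrightarrow> P (s + t)"
  shows "P t"
proof -
  have "P 0" using single[of _ 0] by simp
  then have "P (\<Sum>k\<in>S. Poly_Mapping.single k (f k))" for S and f :: "'a \<Rightarrow> 'b"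
    by (induction S rule: infinite_finite_induct) (auto intro: single add)
  then show ?thesis using pm_eq_sum_single[of t] by metis
qed

text \<open>The word \<open>i # w\<close> is \<open>gen i\<close> times \<open>w\<close>, and the
  scalar can be left on the empty word. This form suits properties that are stable under products,
  such as those of twisted derivations.\<close>

lemma falg_induct [case_names const gen add mult]:
  fixes P :: "'n falg \<Rightarrow> bool"
  assumes const: "\<And>c. P (Poly_Mapping.single [] c)"
    and gen: "\<And>i. P (gen i)"
    and add: "\<And>u v. P u \<Longrightarrow> P v \<Longrightarrow> P (u + v)"
    and mult: "\<And>u v. P u \<Longrightarrow> P v \<Longrightarrow> P (u * v)"
  shows "P u"
proof (induction u rule: pm_additive_induct)
  case (single w c)
  show ?case
  proof (induction w)
    case (Cons i w)
    have "Poly_Mapping.single (i # w) c = gen i * Poly_Mapping.single w c"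
      by (simp add: gen_def word_mult)
    then show ?case using mult[OF gen Cons] by simp
  qed (rule const)
qed (rule add)

section \<open>The grading\<close>

lemma tgrade_zero: "0 \<in> tgrade m"
  by (simp add: tgrade_def)

lemma tgrade_add: "s \<in> tgrade m \<Longrightarrow> t \<in> tgrade m \<Longrightarrow> s + t \<in> tgrade m"
  using Poly_Mapping.keys_add[of s t] by (auto simp: tgrade_def)

lemma tgrade_sum: "(\<And>i. i \<in> S \<Longrightarrow> f i \<in> tgrade m) \<Longrightarrow> (\<Sum>i\<in>S. f i) \<in> tgrade m"
  by (induction S rule: infinite_finite_induct) (auto intro: tgrade_zero tgrade_add)

lemma tgrade_single: "word_grade w = m \<Longrightarrow> Poly_Mapping.single w r \<in> tgrade m"
  by (simp add: tgrade_def)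

lemma word_grade_simps: "word_grade [] = 0" "word_grade (b # w) = sym_grade b + word_grade w"
  "word_grade (w @ v) = word_grade w + word_grade v"
  by (simp_all add: word_grade_def)

lemma tgrade_induct [consumes 1, case_names zero single add]:
  assumes t: "t \<in> tgrade m"
    and zero: "P 0"
    and single: "\<And>w r. word_grade w = m \<Longrightarrow> P (Poly_Mapping.single w r)"
    and add: "\<And>s t. s \<in> tgrade m \<Longrightarrow> t \<in> tgrade m \<Longrightarrow> P s \<Longrightarrow> P t \<Longrightarrow> P (s + t)"
  shows "P t"
proof -
  have "P (\<Sum>k\<in>S. Poly_Mapping.single k (f k))" if "\<forall>w\<in>S. word_grade w = m"
    for S and f :: "'a bsym list \<Rightarrow> 'a falg"
    using that
    by (induction S rule: infinite_finite_induct)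
      (auto intro!: zero single add tgrade_single tgrade_sum)
  moreover have "\<forall>w\<in>Poly_Mapping.keys t. word_grade w = m"
    using t by (simp add: tgrade_def)
  ultimately show ?thesis using pm_eq_sum_single[of t] by metis
qed

text \<open>About the class product, not \<open>tmul\<close>: both \<open>tmul\<close> and
  \<open>tscale\<close> are written with it, and their grades are deduced from here.\<close>

lemma tgrade_times:
  "s \<in> tgrade m \<Longrightarrow> t \<in> tgrade k \<Longrightarrow> s * t \<in> tgrade (m + k)"
proof (induction rule: tgrade_induct)
  case (single w r)
  from single(2) show ?case
    by (induction rule: tgrade_induct)
      (auto simp: tgrade_zero word_mult word_grade_simps single distrib_left
        intro: tgrade_add tgrade_single)
qed (auto simp: tgrade_zero distrib_right intro: tgrade_add)

lemma tgrade_tscale: "t \<in> tgrade m \<Longrightarrow> tscale c t \<in> tgrade m"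
  using tgrade_times[OF tgrade_single[of "[]" 0]] by (simp add: tscale_eq_times word_grade_simps)

lemma tgrade_diff: "s \<in> tgrade m \<Longrightarrow> t \<in> tgrade m \<Longrightarrow> s - t \<in> tgrade m"
  using tgrade_add[OF _ tgrade_tscale[of t m "-1"]] by (simp add: tscale_minus_left tscale_one)

lemma map_bsym_simps:
  "idx (map_bsym (\<lambda>_. k) b) = k" "map_bsym (\<lambda>_. l) (map_bsym (\<lambda>_. k) b) = map_bsym (\<lambda>_. l) b"
  "map_bsym (\<lambda>_. idx b) b = b" "sym_grade (map_bsym f b) = sym_grade b"
  by (cases b; simp)+

section \<open>Homogeneous components\<close>

definition hproj :: "nat \<Rightarrow> 'n tens \<Rightarrow> 'n tens" where
  "hproj m t = (\<Sum>w\<in>{w \<in> Poly_Mapping.keys t. word_grade w = m}.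
     Poly_Mapping.single w (Poly_Mapping.lookup t w))"

lemma lookup_hproj:
  "Poly_Mapping.lookup (hproj m t) w = (if word_grade w = m then Poly_Mapping.lookup t w else 0)"
  by (auto simp: hproj_def lookup_sum lookup_single when_def sum.delta' in_keys_iff)

lemma hproj_add: "hproj m (s + t) = hproj m s + hproj m t"
  and hproj_diff: "hproj m (s - t) = hproj m s - hproj m t"
  by (rule poly_mapping_eqI; simp add: lookup_hproj lookup_add lookup_minus)+

lemma hproj_zero: "hproj m 0 = 0"
  by (simp add: hproj_def)

lemma hproj_tgrade: "t \<in> tgrade k \<Longrightarrow> hproj m t = (if m = k then t else 0)"
  by (rule poly_mapping_eqI) (auto simp: lookup_hproj tgrade_def in_keys_iff)

lemma hproj_in_tgrade: "hproj m t \<in> tgrade m"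
  by (auto simp: tgrade_def in_keys_iff lookup_hproj split: if_splits)

lemma hproj_eq_zero: "m \<notin> word_grade ` Poly_Mapping.keys t \<Longrightarrow> hproj m t = 0"
  by (rule poly_mapping_eqI) (auto simp: lookup_hproj in_keys_iff)

lemma sum_hproj:
  assumes "finite S" "word_grade ` Poly_Mapping.keys t \<subseteq> S"
  shows "(\<Sum>m\<in>S. hproj m t) = t"
proof (rule poly_mapping_eqI)
  fix w
  show "Poly_Mapping.lookup (\<Sum>m\<in>S. hproj m t) w = Poly_Mapping.lookup t w"
    using assms by (cases "w \<in> Poly_Mapping.keys t") (auto simp: lookup_sum lookup_hproj in_keys_iff)
qed

section \<open>The primitive cube root of unity\<close>

lemma qroot_cube: "qroot ^ 3 = 1"
proof -
  have "qroot ^ 3 = exp (of_nat 3 * (2 * of_real pi * \<i> / 3))"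
    by (simp only: qroot_def exp_of_nat_mult)
  also have "of_nat 3 * (2 * of_real pi * \<i> / 3) = 2 * of_real pi * \<i>" by simp
  finally show ?thesis by simp
qed

text \<open>\<open>qroot\<close> is a root of X^3 - 1 other than 1, its real part being
  -1/2.\<close>

lemma qroot_sum: "1 + qroot + qroot\<^sup>2 = 0"
proof -
  have "Re qroot = cos (2 * pi / 3)"
    by (simp add: qroot_def Re_exp)
  then have "qroot \<noteq> 1"
    by (auto simp: cos_120)
  moreover have "(qroot - 1) * (1 + qroot + qroot\<^sup>2) = 0"
    using qroot_cube by (simp add: algebra_simps power2_eq_square power3_eq_cube)
  ultimately show ?thesis by simp
qed

section \<open>The Leibniz rule on the tensor algebra\<close>

context
  fixes \<xi> :: "'n::finite falg \<Rightarrow> 'n falg ^ 'n ^ 'n"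
  assumes hom: "mat_alg_hom \<xi>"
begin

abbreviation (input) mul :: "'n tens \<Rightarrow> 'n tens \<Rightarrow> 'n tens" (infixl "\<star>" 70) where
  "s \<star> t \<equiv> tmul \<xi> s t"

abbreviation (input) diff :: "'n tens \<Rightarrow> 'n tens" ("\<d>") where
  "\<d> \<equiv> tdiff \<xi>"

lemmas mul_assoc = tmul_assoc[OF hom]
  and mul_add_left = tmul_add_left[OF hom]
  and mul_add_right = tmul_add_right[OF hom]
  and mul_one_left = tmul_one_left[OF hom]
  and mul_one_right = tmul_one_right[OF hom]

lemma mul_zero: "0 \<star> t = 0" "t \<star> 0 = 0"
  using mul_add_left[of 0 0 t] mul_add_right[of t 0 0] by simp_all

lemma mul_diff_left: "(s - s') \<star> t = s \<star> t - s' \<star> t"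
  and mul_diff_right: "t \<star> (s - s') = t \<star> s - t \<star> s'"
  using mul_add_left[of "s - s'" s' t] mul_add_right[of t "s - s'" s'] by simp_all

lemma mul_sum_left: "(\<Sum>i\<in>S. f i) \<star> t = (\<Sum>i\<in>S. f i \<star> t)"
  by (rule additive_sum) (rule mul_add_left)

lemma mul_sum_right: "t \<star> (\<Sum>i\<in>S. f i) = (\<Sum>i\<in>S. t \<star> f i)"
  by (rule additive_sum) (rule mul_add_right)

lemma single_mul_word: "Poly_Mapping.single w 1 \<star> t = Poly_Mapping.single w 1 * t"
  by (simp add: tmul_single[OF hom] lact_tens_one[OF hom])

lemma single_Cons: "Poly_Mapping.single (b # w) r = of_sym b \<star> Poly_Mapping.single w r"
  by (simp add: of_sym_def single_mul_word word_mult)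

lemma single_Nil: "Poly_Mapping.single [] r = of_falg r"
  by (simp add: of_falg_def)

lemma of_falg_mult: "of_falg (u * v) = of_falg u \<star> of_falg v"
  by (simp add: of_falg_def tmul_single[OF hom] lact_tens_single[OF hom] one_word) (simp add: word_mult)

lemma of_falg_add: "of_falg (u + v) = of_falg u + of_falg v"
  by (simp add: of_falg_def single_add)

lemma of_falg_zero: "of_falg 0 = 0"
  by (simp add: of_falg_def)

lemma of_falg_sum: "of_falg (\<Sum>i\<in>S. f i) = (\<Sum>i\<in>S. of_falg (f i))"
  by (rule additive_sum) (rule of_falg_add)

lemma of_falg_sym: "of_falg u \<star> of_sym b =
    (\<Sum>k\<in>UNIV. of_sym (map_bsym (\<lambda>_. k) b) \<star> of_falg (\<xi> u $ k $ idx b))"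
  by (rule left_act_sym[OF hom])

text \<open>Being linear and unital, \<xi> sends scalars to scalar matrices; hence constants cross
  every basis symbol unchanged.\<close>

lemma hom_const: "\<xi> (Poly_Mapping.single [] c) $ k $ j = (if k = j then Poly_Mapping.single [] c else 0)"
proof -
  have "Poly_Mapping.single [] c = cscale c (1::'n falg)" by (simp add: cscale_mult)
  then show ?thesis
    by (simp only: hom_scale[OF hom] hom_one[OF hom]) (simp add: mat_def cscale_mult)
qed

lemma sum_sym: "(\<Sum>k\<in>UNIV. of_sym (map_bsym (\<lambda>_. k) b) \<star> f (if k = idx b then r else 0)) =
    of_sym b \<star> f r" if "f 0 = 0" for f :: "'n falg \<Rightarrow> 'n tens"
proof -
  have "(\<Sum>k\<in>UNIV. of_sym (map_bsym (\<lambda>_. k) b) \<star> f (if k = idx b then r else 0)) =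
      (\<Sum>k\<in>UNIV. if k = idx b then of_sym (map_bsym (\<lambda>_. k) b) \<star> f r else 0)"
    by (intro sum.cong) (auto simp: that mul_zero)
  then show ?thesis by (simp add: map_bsym_simps)
qed

lemma const_mul_single:
  "of_falg (Poly_Mapping.single [] c) \<star> Poly_Mapping.single w r = tscale c (Poly_Mapping.single w r)"
proof (induction w)
  case Nil
  then show ?case by (simp add: single_Nil of_falg_mult[symmetric])
      (simp add: of_falg_def tscale_single cscale_mult)
next
  case (Cons b w)
  have "of_falg (Poly_Mapping.single [] c) \<star> of_sym b = of_sym b \<star> of_falg (Poly_Mapping.single [] c)"
    using sum_sym[of of_falg] by (simp add: of_falg_sym hom_const of_falg_zero)
  then have "of_falg (Poly_Mapping.single [] c) \<star> Poly_Mapping.single (b # w) r =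
      of_sym b \<star> tscale c (Poly_Mapping.single w r)"
    by (simp add: single_Cons mul_assoc[symmetric] Cons[symmetric])
  then show ?case by (metis tscale_single single_Cons)
qed

lemma const_mul: "of_falg (Poly_Mapping.single [] c) \<star> t = tscale c t"
  by (rule pm_additive_ext[of "\<lambda>t. of_falg (Poly_Mapping.single [] c) \<star> t" "tscale c"])
    (simp_all add: mul_add_right tscale_add const_mul_single)

lemma mul_const: "t \<star> of_falg (Poly_Mapping.single [] c) = tscale c t"
  by (rule pm_additive_ext[of "\<lambda>t. t \<star> of_falg (Poly_Mapping.single [] c)" "tscale c"])
    (simp_all add: mul_add_left tscale_add tmul_single[OF hom] of_falg_def lact_tens_single[OF hom]
      word_mult tscale_single cscale_mult cscale_central)

text \<open>Scaling is multiplication by a constant, from the left here and from the right in the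
  next lemma, so both are instances of associativity.\<close>

lemma tscale_mul_left: "tscale c s \<star> t = tscale c (s \<star> t)"
  by (simp add: const_mul[symmetric] mul_assoc)

lemma tscale_mul_right: "s \<star> tscale c t = tscale c (s \<star> t)"
  by (simp add: mul_const[symmetric] mul_assoc)

lemma of_sym_in_tgrade: "of_sym b \<in> tgrade (sym_grade b)"
  by (simp add: of_sym_def tgrade_single word_grade_simps)

lemma of_falg_in_tgrade: "of_falg r \<in> tgrade 0"
  by (simp add: of_falg_def tgrade_single word_grade_simps)

lemma lact_word_in_tgrade: "lact_word \<xi> u w \<in> tgrade (word_grade w)"
proof (induction w arbitrary: u)
  case (Cons b w)
  have "Poly_Mapping.single [map_bsym (\<lambda>_. k) b] 1 * lact_word \<xi> v w \<in> tgrade (sym_grade b + word_grade w)"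
    for k v
    by (rule tgrade_times[OF tgrade_single Cons]) (simp add: word_grade_simps map_bsym_simps)
  then show ?case by (auto simp: word_grade_simps intro!: tgrade_sum)
qed (simp add: tgrade_single)

lemma mul_in_tgrade: "s \<in> tgrade m \<Longrightarrow> t \<in> tgrade k \<Longrightarrow> s \<star> t \<in> tgrade (m + k)"
proof (induction rule: tgrade_induct)
  case (single w r)
  from single(2) have "lact_tens \<xi> r t \<in> tgrade k"
  proof (induction rule: tgrade_induct)
    case (single v a)
    then show ?case
      using tgrade_times[OF lact_word_in_tgrade tgrade_single[of "[]" 0]]
      by (simp add: lact_tens_single[OF hom] word_grade_simps) metis
  next
    case zero
    then show ?case by (simp add: lact_tens_def tgrade_zero)
  qed (auto simp: lact_tens_add[OF hom] intro: tgrade_add)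
  then show ?case by (simp add: tmul_single[OF hom] tgrade_times tgrade_single single)
qed (auto simp: mul_zero tgrade_zero mul_add_left intro: tgrade_add)

section \<open>Partial derivatives and linearity of the differential\<close>

lemma pderiv_right_add: "pderiv_right \<xi> s (u + v) = pderiv_right \<xi> s u + pderiv_right \<xi> s v"
  and pderiv_right_scale: "pderiv_right \<xi> s (cscale c u) = cscale c (pderiv_right \<xi> s u)"
  and pderiv_right_gen: "pderiv_right \<xi> s (gen i) = (if s = i then 1 else 0)"
  and pderiv_right_mult: "pderiv_right \<xi> s (u * v) =
    pderiv_right \<xi> s u * v + (\<Sum>j\<in>UNIV. \<xi> u $ s $ j * pderiv_right \<xi> j v)"
  using d1_coord_differential[OF hom]
  by (simp_all add: coord_differential_def pderiv_right_def axis_def ract_def lact_def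
      matrix_vector_mult_def)

lemma pderiv_right_one: "pderiv_right \<xi> s 1 = 0"
  using pderiv_right_mult[of s 1 1] by (simp add: hom_one[OF hom] mat_def if_distrib[of "\<lambda>x. x * _"] cong: if_cong)

lemma raise_at_add: "raise_at j w (r + r') = raise_at j w r + raise_at j w r'"
  by (simp add: raise_at_def single_add split: bsym.split)

lemma raise_at_scale: "raise_at j w (cscale c r) = tscale c (raise_at j w r)"
  by (simp add: raise_at_def tscale_single tscale_zero split: bsym.split)

lemma tdiff_term_add: "tdiff_term \<xi> w (r + r') = tdiff_term \<xi> w r + tdiff_term \<xi> w r'"
  by (simp add: tdiff_term_def raise_at_add pderiv_right_add single_add tscale_add sum.distrib)

lemma diff_add: "\<d> (s + t) = \<d> s + \<d> t"
proof -
  have "tdiff_term \<xi> w 0 = 0" for w using tdiff_term_add[of w 0 0] by simp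
  then show ?thesis unfolding tdiff_def by (intro keys_sum_add tdiff_term_add)
qed

lemma diff_single: "\<d> (Poly_Mapping.single w r) = tdiff_term \<xi> w r"
proof -
  have "tdiff_term \<xi> w 0 = 0" using tdiff_term_add[of w 0 0] by simp
  then show ?thesis by (simp add: tdiff_def)
qed

lemma diff_zero: "\<d> 0 = 0"
  using diff_add[of 0 0] by simp

lemma diff_diff: "\<d> (s - t) = \<d> s - \<d> t"
  using diff_add[of "s - t" t] by simp

lemma diff_minus: "\<d> (- t) = - \<d> t"
  using diff_diff[of 0 t] by (simp add: diff_zero)

lemma diff_sum: "\<d> (\<Sum>i\<in>S. f i) = (\<Sum>i\<in>S. \<d> (f i))"
  by (rule additive_sum) (rule diff_add)

lemma diff_scale: "\<d> (tscale c t) = tscale c (\<d> t)"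
proof (rule pm_additive_ext[of "\<lambda>t. \<d> (tscale c t)"])
  fix w r
  show "\<d> (tscale c (Poly_Mapping.single w r)) = tscale c (\<d> (Poly_Mapping.single w r))"
    unfolding tscale_single diff_single tdiff_term_def
    by (simp add: raise_at_scale pderiv_right_scale tscale_add tscale_sum tscale_tscale mult.commute
        flip: tscale_single)
qed (simp_all add: diff_add tscale_add)

lemma diff_of_falg: "\<d> (of_falg r) = (\<Sum>s\<in>UNIV. of_sym (Dx s) \<star> of_falg (pderiv_right \<xi> s r))"
  by (simp add: of_falg_def diff_single tdiff_term_def word_grade_simps tscale_one flip: single_Cons)

lemma diff_gen: "\<d> (of_falg (gen i)) = of_sym (Dx i)"
  using sum_sym[of of_falg "Dx i" 1] by (simp add: diff_of_falg pderiv_right_gen of_falg_zero mul_one_right)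

lemma diff_const: "\<d> (of_falg (Poly_Mapping.single [] c)) = 0"
proof -
  have "Poly_Mapping.single [] c = cscale c (1::'n falg)" by (simp add: cscale_mult)
  then have "pderiv_right \<xi> s (Poly_Mapping.single [] c) = 0" for s
    by (simp only: pderiv_right_scale pderiv_right_one) (simp add: cscale_mult)
  then show ?thesis by (simp add: diff_of_falg of_falg_zero mul_zero)
qed

lemma diff_of_sym: "\<d> (of_sym (Dx i)) = of_sym (DDx i)" "\<d> (of_sym (DDx i)) = 0"
  by (simp_all add: of_sym_def diff_single tdiff_term_def raise_at_def pderiv_right_one
      word_grade_simps tscale_one tscale_zero)

text \<open>In a canonical term \<open>b # w\<close> the sum over positions splits into position 0,
  which differentiates \<open>b\<close>, and the shifted positions of \<open>w\<close>, whose powers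
  of q all carry the extra exponent \<open>sym_grade b\<close>. Nothing has to cross
  \<open>b\<close>, so there is no error term.\<close>

lemma diff_sym_mul: "\<d> (of_sym b \<star> t) =
    \<d> (of_sym b) \<star> t + tscale (qroot ^ sym_grade b) (of_sym b \<star> \<d> t)"
proof (rule pm_additive_ext[of "\<lambda>t. \<d> (of_sym b \<star> t)"])
  fix w r
  have head: "raise_at 0 (b # w) r = \<d> (of_sym b) \<star> Poly_Mapping.single w r"
    by (cases b) (simp_all add: raise_at_def diff_of_sym mul_zero single_Cons)
  have tail: "raise_at (Suc j) (b # w) r = of_sym b \<star> raise_at j w r" for j
    by (simp add: raise_at_def single_Cons mul_zero split: bsym.split)
  show "\<d> (of_sym b \<star> Poly_Mapping.single w r) = \<d> (of_sym b) \<star> Poly_Mapping.single w r +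
      tscale (qroot ^ sym_grade b) (of_sym b \<star> \<d> (Poly_Mapping.single w r))"
    by (simp add: single_Cons[symmetric] diff_single)
      (simp add: tdiff_term_def word_grade_simps sum.lessThan_Suc_shift head tail
        tscale_mul_right mul_add_right mul_sum_right tscale_add tscale_sum tscale_tscale power_add
        single_Cons add.assoc tscale_one del: sum.lessThan_Suc)
qed (simp_all add: diff_add mul_add_right tscale_add)

lemma diff_in_tgrade: "t \<in> tgrade m \<Longrightarrow> \<d> t \<in> tgrade (m + 1)"
proof (induction rule: tgrade_induct)
  case (single w r)
  have "\<d> (Poly_Mapping.single w r) \<in> tgrade (word_grade w + 1)"
  proof (induction w)
    case Nil
    show ?case unfolding single_Nil diff_of_falg
      using mul_in_tgrade[OF of_sym_in_tgrade[of "Dx _"] of_falg_in_tgrade]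
      by (auto simp: word_grade_simps intro!: tgrade_sum)
  next
    case (Cons b w)
    have "\<d> (of_sym b) \<in> tgrade (sym_grade b + 1)"
      using of_sym_in_tgrade[of "DDx (idx b)"] by (cases b) (auto simp: diff_of_sym tgrade_zero numeral_2_eq_2)
    from mul_in_tgrade[OF this tgrade_single[OF refl]] mul_in_tgrade[OF of_sym_in_tgrade Cons]
    show ?case by (auto simp: single_Cons diff_sym_mul word_grade_simps add_ac intro!: tgrade_add tgrade_tscale)
  qed
  then show ?case by (simp add: single)
qed (auto simp: diff_zero diff_add tgrade_zero intro: tgrade_add)

section \<open>Two-sided ideals\<close>

text \<open>The outer factors are taken homogeneous because the Leibniz rule only speaks of those.\<close>

inductive_set tideal :: "'n tens set \<Rightarrow> 'n tens set" for G where
  zero: "0 \<in> tideal G"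
| add: "x \<in> tideal G \<Longrightarrow> y \<in> tideal G \<Longrightarrow> x + y \<in> tideal G"
| sandwich: "g \<in> G \<Longrightarrow> s \<in> tgrade m \<Longrightarrow> t \<in> tgrade k \<Longrightarrow> s \<star> g \<star> t \<in> tideal G"

lemma tideal_base: "g \<in> G \<Longrightarrow> g \<in> tideal G"
  using sandwich[of g G "of_falg 1" 0 "of_falg 1" 0]
  by (simp add: of_falg_in_tgrade mul_one_left mul_one_right)

text \<open>\<open>sandwich\<close> admits homogeneous factors only; an arbitrary \<open>s\<close>
  is a sum of canonical terms, each homogeneous and absorbed into the left factor.\<close>

lemma tideal_left: "x \<in> tideal G \<Longrightarrow> s \<star> x \<in> tideal G"
proof (induction rule: tideal.induct)
  case (sandwich g s' m t k)
  show ?case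
  proof (induction s rule: pm_additive_induct)
    case (single w r)
    show ?case
      using tideal.sandwich[OF sandwich(1) mul_in_tgrade[OF tgrade_single[OF refl] sandwich(2)] sandwich(3)]
      by (simp add: mul_assoc)
  qed (simp add: mul_add_left tideal.add)
qed (simp_all add: mul_zero mul_add_right tideal.zero tideal.add)

lemma tideal_right: "x \<in> tideal G \<Longrightarrow> x \<star> s \<in> tideal G"
proof (induction rule: tideal.induct)
  case (sandwich g s' m t k)
  show ?case
  proof (induction s rule: pm_additive_induct)
    case (single w r)
    show ?case
      using tideal.sandwich[OF sandwich(1,2) mul_in_tgrade[OF sandwich(3) tgrade_single[OF refl]]]
      by (simp add: mul_assoc)
  qed (simp add: mul_add_right tideal.add)
qed (simp_all add: mul_zero mul_add_left tideal.zero tideal.add)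

lemma tideal_scale: "x \<in> tideal G \<Longrightarrow> tscale c x \<in> tideal G"
  unfolding const_mul[symmetric] by (rule tideal_left)

lemma tideal_minus: "x \<in> tideal G \<Longrightarrow> - x \<in> tideal G"
  using tideal_scale[of x G "-1"] by (simp add: tscale_minus_left tscale_one)

lemma tideal_diff: "x \<in> tideal G \<Longrightarrow> y \<in> tideal G \<Longrightarrow> x - y \<in> tideal G"
  using tideal.add[OF _ tideal_minus, of x G y] by simp

lemma tideal_sum: "(\<And>i. i \<in> S \<Longrightarrow> f i \<in> tideal G) \<Longrightarrow> (\<Sum>i\<in>S. f i) \<in> tideal G"
  by (induction S rule: infinite_finite_induct) (auto intro: tideal.intros)

lemma tideal_least:
  assumes "G \<subseteq> tideal H" shows "tideal G \<subseteq> tideal H"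
proof
  fix x assume "x \<in> tideal G"
  then show "x \<in> tideal H"
    using assms by induction (auto intro: tideal.zero tideal.add tideal_left tideal_right)
qed

text \<open>Each \<open>s \<star> g \<star> t\<close> of the inductive description is homogeneous,
  so the projection keeps it or kills it. This makes the sum of the grades direct in the
  quotient.\<close>

lemma hproj_tideal:
  assumes "\<And>g. g \<in> G \<Longrightarrow> \<exists>m. g \<in> tgrade m" and "x \<in> tideal G"
  shows "hproj m x \<in> tideal G"
  using assms(2)
proof induction
  case (sandwich g s a t b)
  obtain k where "g \<in> tgrade k" using assms(1) sandwich(1) by blast
  with sandwich have "s \<star> g \<star> t \<in> tgrade (a + k + b)"
    by (intro mul_in_tgrade)
  then show ?case
    using tideal.sandwich[OF sandwich] by (simp add: hproj_tgrade tideal.zero)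
qed (simp_all add: hproj_zero hproj_add tideal.zero tideal.add)

section \<open>The Leibniz rule up to relations\<close>

text \<open>The obstructions to the Leibniz rule for the products \<open>a \<otimes> b\<close> of an algebra element and a
  basis symbol. For \<open>a = x\<^sup>i\<close> these are the third and the fourth family of generators of
  \<open>I\<^sub>q\<close>, and \<open>leib_ideal\<close> is the ideal that they generate.\<close>

definition leib :: "'n falg \<Rightarrow> 'n bsym \<Rightarrow> 'n tens" where
  "leib a b = \<d> (of_falg a) \<star> of_sym b - tscale (qroot ^ sym_grade b)
     (\<Sum>k\<in>UNIV. of_sym (map_bsym (\<lambda>_. k) b) \<star> \<d> (of_falg (\<xi> a $ k $ idx b)))"

definition leib_ideal :: "'n tens set" where
  "leib_ideal = tideal {leib (gen i) b | i b. True}"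

text \<open>The defect of the q-Leibniz rule. The grade is a parameter because zero has every grade;
  once it is fixed, the defect is additive in both arguments.\<close>

definition lerr :: "nat \<Rightarrow> 'n tens \<Rightarrow> 'n tens \<Rightarrow> 'n tens" where
  "lerr m s t = \<d> (s \<star> t) - \<d> s \<star> t - tscale (qroot ^ m) (s \<star> \<d> t)"

text \<open>Exact, since moving \<open>u\<close> across dx^j by means of \<xi>(u) is just what the
  twisted product rule of the partial derivatives records.\<close>

lemma diff_of_falg_mult: "\<d> (of_falg (u * v)) = \<d> (of_falg u) \<star> of_falg v + of_falg u \<star> \<d> (of_falg v)"
proof -
  have "of_falg u \<star> \<d> (of_falg v) = (\<Sum>j\<in>UNIV. \<Sum>s\<in>UNIV.
      of_sym (Dx s) \<star> of_falg (\<xi> u $ s $ j * pderiv_right \<xi> j v))"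
    by (simp add: diff_of_falg mul_sum_right mul_assoc[symmetric] of_falg_sym mul_sum_left)
      (simp add: mul_assoc of_falg_mult)
  also have "\<dots> = (\<Sum>s\<in>UNIV. of_sym (Dx s) \<star>
      of_falg (\<Sum>j\<in>UNIV. \<xi> u $ s $ j * pderiv_right \<xi> j v))"
    by (subst sum.swap) (simp add: mul_sum_right of_falg_sum)
  finally have "of_falg u \<star> \<d> (of_falg v) = \<dots>" .
  moreover have "\<d> (of_falg u) \<star> of_falg v =
      (\<Sum>s\<in>UNIV. of_sym (Dx s) \<star> of_falg (pderiv_right \<xi> s u * v))"
    by (simp add: diff_of_falg mul_sum_left mul_assoc of_falg_mult)
  ultimately show ?thesis
    unfolding diff_of_falg[of "u * v"]
    by (simp add: pderiv_right_mult of_falg_add mul_add_right sum.distrib)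
qed

lemma leib_add: "leib (u + v) b = leib u b + leib v b"
  by (simp add: leib_def of_falg_add diff_add mul_add_left mul_add_right hom_add[OF hom]
      sum.distrib tscale_add)

lemma leib_const: "leib (Poly_Mapping.single [] c) b = 0"
proof -
  have "\<d> (of_falg (\<xi> (Poly_Mapping.single [] c) $ k $ j)) = 0" for k j
    by (simp add: hom_const diff_const of_falg_zero diff_zero)
  then show ?thesis by (simp add: leib_def diff_const mul_zero tscale_zero)
qed

text \<open>Moving \<open>v\<close> across \<open>b\<close> replaces it by a column of \<xi>(v).
  Multiplicativity of \<xi>, followed by the product rule on the algebra, splits the subtracted sum
  in the same pattern.\<close>

lemma leib_mult: "leib (u * v) b =
    (\<Sum>k\<in>UNIV. leib u (map_bsym (\<lambda>_. k) b) \<star> of_falg (\<xi> v $ k $ idx b)) + of_falg u \<star> leib v b"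
proof -
  let ?b = "\<lambda>k. of_sym (map_bsym (\<lambda>_. k) b)" and ?q = "qroot ^ sym_grade b"
  let ?u = "\<lambda>l k. of_falg (\<xi> u $ l $ k)" and ?v = "\<lambda>k. of_falg (\<xi> v $ k $ idx b)"
  have 1: "\<d> (of_falg (u * v)) \<star> of_sym b =
      (\<Sum>k\<in>UNIV. \<d> (of_falg u) \<star> (?b k \<star> ?v k)) + of_falg u \<star> (\<d> (of_falg v) \<star> of_sym b)"
    by (simp add: diff_of_falg_mult mul_add_left mul_assoc of_falg_sym mul_sum_right)
  have 2: "(\<Sum>l\<in>UNIV. ?b l \<star> \<d> (of_falg (\<xi> (u * v) $ l $ idx b))) =
      (\<Sum>k\<in>UNIV. \<Sum>l\<in>UNIV. ?b l \<star> (\<d> (?u l k) \<star> ?v k)) +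
      (\<Sum>k\<in>UNIV. \<Sum>l\<in>UNIV. ?b l \<star> (?u l k \<star> \<d> (?v k)))"
    by (subst (1 2) sum.swap)
      (simp add: hom_mult[OF hom] matrix_matrix_mult_def of_falg_sum diff_sum diff_of_falg_mult
        mul_sum_right mul_add_right sum.distrib)
  \<comment> \<open>Entries of \<xi>(u) behind the symbols amount to \<open>u\<close> in front of
    them, so the second double sum of 2 belongs to \<open>leib v b\<close>.\<close>
  have 3: "of_falg u \<star> (\<Sum>k\<in>UNIV. ?b k \<star> \<d> (?v k)) =
      (\<Sum>k\<in>UNIV. \<Sum>l\<in>UNIV. ?b l \<star> (?u l k \<star> \<d> (?v k)))"
    by (simp add: mul_sum_right mul_assoc[symmetric] of_falg_sym mul_sum_left map_bsym_simps)
  have 4: "(\<Sum>k\<in>UNIV. leib u (map_bsym (\<lambda>_. k) b) \<star> ?v k) =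
      (\<Sum>k\<in>UNIV. \<d> (of_falg u) \<star> (?b k \<star> ?v k)) -
      tscale ?q (\<Sum>k\<in>UNIV. \<Sum>l\<in>UNIV. ?b l \<star> (\<d> (?u l k) \<star> ?v k))"
    by (simp add: leib_def mul_diff_left sum_subtractf tscale_mul_left mul_sum_left map_bsym_simps
        tscale_sum mul_assoc)
  have 5: "of_falg u \<star> leib v b = of_falg u \<star> (\<d> (of_falg v) \<star> of_sym b) -
      tscale ?q (\<Sum>k\<in>UNIV. \<Sum>l\<in>UNIV. ?b l \<star> (?u l k \<star> \<d> (?v k)))"
    by (simp add: leib_def mul_diff_right tscale_mul_right 3)
  show ?thesis
    unfolding 4 5 by (simp add: leib_def 1 2 tscale_add)
qed

text \<open>By \<open>leib_mult\<close>, the elements \<open>a\<close> for which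
  \<open>leib a b\<close> lies in the ideal for all \<open>b\<close> form a subalgebra. The symbol
  must vary because the product formula changes its index.\<close>

lemma leib_in_leib_ideal: "leib a b \<in> leib_ideal"
  unfolding leib_ideal_def
proof (induction a arbitrary: b rule: falg_induct)
  case (gen i)
  show ?case by (rule tideal_base) blast
qed (auto simp: leib_const leib_add leib_mult
    intro!: tideal.zero tideal.add tideal_sum intro: tideal_left tideal_right)

text \<open>Both kinds of symbols are crossed with the same \<xi>, so the crossing relation survives
  when its symbols are differentiated.\<close>

lemma of_falg_diff_sym: "of_falg a \<star> \<d> (of_sym b) =
    (\<Sum>k\<in>UNIV. \<d> (of_sym (map_bsym (\<lambda>_. k) b)) \<star> of_falg (\<xi> a $ k $ idx b))"
  by (cases b) (simp_all add: diff_of_sym mul_zero of_falg_sym)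

lemma lerr_add_left: "lerr m (s + s') t = lerr m s t + lerr m s' t"
  and lerr_add_right: "lerr m s (t + t') = lerr m s t + lerr m s t'"
  and lerr_zero_left: "lerr m 0 t = 0"
  by (simp_all add: lerr_def diff_add mul_add_left mul_add_right tscale_add mul_zero diff_zero tscale_zero)

lemma lerr_of_falg: "lerr 0 (of_falg a) t \<in> leib_ideal"
proof (induction t rule: pm_additive_induct)
  case (single w r)
  show ?case
  proof (induction w arbitrary: a)
    case Nil
    show ?case
      by (simp add: single_Nil lerr_def of_falg_mult[symmetric] diff_of_falg_mult tscale_one
          leib_ideal_def tideal.zero)
  next
    case (Cons b w)
    let ?b = "\<lambda>k. of_sym (map_bsym (\<lambda>_. k) b)" and ?q = "qroot ^ sym_grade b"
    let ?x = "\<lambda>k. of_falg (\<xi> a $ k $ idx b)" and ?t = "Poly_Mapping.single w r"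
    have "\<d> (of_falg a \<star> (of_sym b \<star> ?t)) = (\<Sum>k\<in>UNIV. \<d> (?b k) \<star> (?x k \<star> ?t)) +
        tscale ?q (\<Sum>k\<in>UNIV. ?b k \<star> \<d> (?x k \<star> ?t))"
      by (simp add: mul_assoc[symmetric] of_falg_sym mul_sum_left)
        (simp add: mul_assoc diff_sum diff_sym_mul sum.distrib tscale_sum map_bsym_simps)
    moreover have "\<d> (?x k \<star> ?t) = lerr 0 (?x k) ?t + \<d> (?x k) \<star> ?t + ?x k \<star> \<d> ?t" for k
      by (simp add: lerr_def tscale_one)
    moreover have "of_falg a \<star> (\<d> (of_sym b) \<star> ?t) = (\<Sum>k\<in>UNIV. \<d> (?b k) \<star> (?x k \<star> ?t))"
      by (simp add: mul_assoc[symmetric] of_falg_diff_sym mul_sum_left)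
    moreover have "of_falg a \<star> (of_sym b \<star> \<d> ?t) = (\<Sum>k\<in>UNIV. ?b k \<star> (?x k \<star> \<d> ?t))"
      by (simp add: mul_assoc[symmetric] of_falg_sym mul_sum_left)
    \<comment> \<open>Crossing \<open>b\<close> costs one \<open>leib a b\<close>; what remains are
      the defects of the entries of \<xi>(a) against the shorter word, hence an induction for all
      \<open>a\<close> at once.\<close>
    ultimately have "lerr 0 (of_falg a) (of_sym b \<star> ?t) =
        tscale ?q (\<Sum>k\<in>UNIV. ?b k \<star> lerr 0 (?x k) ?t) - leib a b \<star> ?t"
      unfolding lerr_def[of 0 "of_falg a"] leib_def
      by (simp add: mul_add_right mul_diff_left sum.distrib tscale_add tscale_mul_left
          tscale_mul_right mul_sum_left mul_assoc diff_sym_mul tscale_one)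
    then show ?case
      using Cons leib_in_leib_ideal[of a b] unfolding single_Cons leib_ideal_def
      by (auto intro!: tideal_diff tideal_scale tideal_sum intro: tideal_left tideal_right)
  qed
qed (simp add: lerr_add_right leib_ideal_def tideal.add)

text \<open>By the exact rule \<open>diff_sym_mul\<close>, the symbols of a term of \<open>s\<close>
  merely pull out of the defect with a power of q, until only its coefficient is left.\<close>

lemma lerr_in_leib_ideal: "s \<in> tgrade m \<Longrightarrow> lerr m s t \<in> leib_ideal"
proof (induction rule: tgrade_induct)
  case (single w r)
  have "lerr (word_grade w) (Poly_Mapping.single w r) t \<in> leib_ideal"
  proof (induction w)
    case Nil
    show ?case using lerr_of_falg by (simp add: single_Nil word_grade_simps)
  next
    case (Cons b w)
    have "lerr (word_grade (b # w)) (Poly_Mapping.single (b # w) r) t =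
        tscale (qroot ^ sym_grade b) (of_sym b \<star> lerr (word_grade w) (Poly_Mapping.single w r) t)"
      by (simp add: lerr_def single_Cons mul_assoc diff_sym_mul mul_add_left mul_diff_right
          tscale_mul_left tscale_mul_right tscale_add tscale_diff tscale_tscale word_grade_simps power_add)
    then show ?case using Cons by (simp add: leib_ideal_def tideal_scale tideal_left)
  qed
  then show ?case by (simp add: single)
qed (simp_all add: lerr_zero_left lerr_add_left leib_ideal_def tideal.zero tideal.add)

lemma diff_mul:
  "\<d> (s \<star> t) = lerr m s t + \<d> s \<star> t + tscale (qroot ^ m) (s \<star> \<d> t)"
  by (simp add: lerr_def)

text \<open>The sets \<open>G\<close> and \<open>H\<close> differ because invariance is first needed for \<open>leib_ideal\<close>, to
  make \<open>d\<^sup>3\<close> a derivation modulo \<open>I\<^sub>q\<close>.\<close>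

lemma diff_tideal:
  assumes H: "leib_ideal \<subseteq> tideal H"
    and G: "\<And>g. g \<in> G \<Longrightarrow> g \<in> tideal H \<and> \<d> g \<in> tideal H \<and> (\<exists>m. g \<in> tgrade m)"
    and x: "x \<in> tideal G"
  shows "\<d> x \<in> tideal H"
  using x
proof induction
  case (sandwich g s a t b)
  obtain m where m: "g \<in> tgrade m" and g: "g \<in> tideal H" "\<d> g \<in> tideal H"
    using G sandwich(1) by blast
  have "lerr a s g \<in> tideal H" "lerr (a + m) (s \<star> g) t \<in> tideal H"
    using lerr_in_leib_ideal mul_in_tgrade m sandwich H by blast+
  with g show ?case
    unfolding diff_mul[of "s \<star> g" t "a + m"] diff_mul[of s g a]
    by (auto simp: mul_add_left intro!: tideal.add tideal_scale intro: tideal_left tideal_right)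
qed (auto simp: diff_zero diff_add intro: tideal.zero tideal.add)

section \<open>The ideal is invariant and contains the third derivatives\<close>

text \<open>Normal form for scalars: 1 + q + q^2 = 0 brings every coefficient to the shape a + b q,
  so identities between powers of q become rewriting. The nested version serves repeated
  differentiation, where factors q pile up.\<close>

lemma qroot_reduce:
  "tscale (qroot\<^sup>2) t = - t - tscale qroot t"
  "tscale qroot (tscale qroot t) = - t - tscale qroot t"
  "tscale (1 - qroot) t = t - tscale qroot t"
proof -
  have "qroot\<^sup>2 = - 1 - qroot"
    using qroot_sum eq_neg_iff_add_eq_0[of "qroot\<^sup>2" "1 + qroot"] by (simp add: add.commute)
  then show "tscale (qroot\<^sup>2) t = - t - tscale qroot t"
    by (simp add: tscale_diff_left tscale_minus_left tscale_one)
  then show "tscale qroot (tscale qroot t) = - t - tscale qroot t"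
    by (simp add: tscale_tscale power2_eq_square)
qed (simp add: tscale_diff_left tscale_one)

text \<open>For \<open>Dx i\<close>, the terms with d^2x^i in front collect the coefficient q^2 (1 +
  q + q^2) = 0 and the last term gets q^3 = 1; for \<open>DDx i\<close> only the last term occurs,
  with q^6 = 1.\<close>

lemma diff3_sym_mul: "\<d> (\<d> (\<d> (of_sym b \<star> t))) = of_sym b \<star> \<d> (\<d> (\<d> t))"
  by (cases b)
    (simp_all add: diff_sym_mul diff_add diff_scale diff_of_sym mul_zero diff_zero tscale_add tscale_diff
      tscale_minus diff_diff diff_minus qroot_reduce)

text \<open>An equation in the tensor algebra itself, with each failure of the Leibniz rule recorded
  as a \<open>lerr\<close>. Two failures occur already in the second derivative and are
  differentiated again. The plain and the scaled copy of one defect stem from the coefficient 1 + q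
  of (d u)(d v) in d^2(u v).\<close>

lemma diff3_of_falg_mult:
  "\<d> (\<d> (\<d> (of_falg (u * v)))) =
     \<d> (lerr 1 (\<d> (of_falg u)) (of_falg v)) + \<d> (lerr 0 (of_falg u) (\<d> (of_falg v))) +
     lerr 2 (\<d> (\<d> (of_falg u))) (of_falg v) + lerr 1 (\<d> (of_falg u)) (\<d> (of_falg v)) +
     tscale qroot (lerr 1 (\<d> (of_falg u)) (\<d> (of_falg v))) +
     lerr 0 (of_falg u) (\<d> (\<d> (of_falg v))) +
     \<d> (\<d> (\<d> (of_falg u))) \<star> of_falg v + of_falg u \<star> \<d> (\<d> (\<d> (of_falg v)))"
  by (simp add: diff_of_falg_mult lerr_def diff_add diff_diff diff_scale tscale_add tscale_diff tscale_one
      tscale_minus qroot_reduce)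

lemma diff3_in_tideal:
  assumes leib: "leib_ideal \<subseteq> tideal H"
    and inv: "\<And>x. x \<in> leib_ideal \<Longrightarrow> \<d> x \<in> tideal H"
  shows "\<d> (\<d> (\<d> t)) \<in> tideal H"
proof -
  have falg: "\<d> (\<d> (\<d> (of_falg r))) \<in> tideal H" for r
  proof (induction r rule: falg_induct)
    case (mult u v)
    have g: "of_falg u \<in> tgrade 0" "\<d> (of_falg u) \<in> tgrade 1" "\<d> (\<d> (of_falg u)) \<in> tgrade 2"
      using diff_in_tgrade[OF of_falg_in_tgrade] diff_in_tgrade[OF diff_in_tgrade[OF of_falg_in_tgrade]]
      by (auto simp: of_falg_in_tgrade numeral_2_eq_2)
    have J: "lerr 0 (of_falg u) t \<in> leib_ideal" "lerr 1 (\<d> (of_falg u)) t \<in> leib_ideal"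
      "lerr 2 (\<d> (\<d> (of_falg u))) t \<in> leib_ideal" for t
      by (rule lerr_in_leib_ideal, rule g)+
    note I = subsetD[OF leib]
    show ?case
      unfolding diff3_of_falg_mult
      by (intro tideal.add tideal_left[OF mult(2)] tideal_right[OF mult(1)] tideal_scale[OF I[OF J(2)]]
          inv[OF J(1)] inv[OF J(2)] I[OF J(1)] I[OF J(2)] I[OF J(3)])
  qed (simp_all add: diff_const diff_gen diff_of_sym diff_zero of_falg_add diff_add tideal.zero tideal.add)
  show ?thesis
  proof (induction t rule: pm_additive_induct)
    case (single w r)
    show ?case
      by (induction w) (simp_all add: single_Nil falg single_Cons diff3_sym_mul tideal_left)
  qed (simp add: diff_add tideal.add)
qed

lemma leib_gen:
  "leib (gen i) (Dx j) = of_sym (Dx i) \<star> of_sym (Dx j) -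
    tscale qroot (\<Sum>k\<in>UNIV. of_sym (Dx k) \<star> \<d> (xi_coord \<xi> i j k))"
  "leib (gen i) (DDx j) = of_sym (Dx i) \<star> of_sym (DDx j) -
    tscale (qroot\<^sup>2) (\<Sum>k\<in>UNIV. of_sym (DDx k) \<star> \<d> (xi_coord \<xi> i j k))"
  by (simp_all add: leib_def diff_gen xi_coord_def)

text \<open>The first two families vanish by the bimodule relation, the third and fourth are
  \<open>leib\<close> at a generator, and of the sixth only the shape of a third derivative of an
  algebra element is retained.\<close>

lemma ideal_gens_cases [consumes 1, case_names rel0 leib rel5 rel6 rel7]:
  assumes "g \<in> ideal_gens \<xi>"
  obtains (rel0) "g = 0"
  | (leib) i b where "g = leib (gen i) b"
  | (rel5) i j where "g = of_sym (DDx i) \<star> of_sym (Dx j)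
      + tscale (1 - qroot) (\<Sum>k\<in>UNIV. of_sym (DDx k) \<star> \<d> (xi_coord \<xi> i j k))
      - tscale (qroot\<^sup>2) (\<Sum>k\<in>UNIV. of_sym (Dx k) \<star> \<d> (\<d> (xi_coord \<xi> i j k)))"
  | (rel6) r where "g = \<d> (\<d> (\<d> (of_falg r)))"
  | (rel7) i j where "g = of_sym (DDx i) \<star> of_sym (DDx j)
      - tscale qroot (\<Sum>k\<in>UNIV. of_sym (DDx k) \<star> \<d> (\<d> (xi_coord \<xi> i j k)))"
  using assms unfolding ideal_gens_def Let_def
  apply (elim UnE CollectE exE conjE)
  subgoal by (rule rel0) (simp add: of_falg_sym xi_coord_def)
  subgoal by (rule rel0) (simp add: of_falg_sym xi_coord_def)
  subgoal for i j by (rule leib[of i "Dx j"]) (simp add: leib_gen)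
  subgoal for i j by (rule leib[of i "DDx j"]) (simp add: leib_gen)
  subgoal by (rule rel5)
  subgoal by (rule rel6) (simp add: xi_coord_def)
  subgoal by (rule rel7)
  done

lemma ideal_gens_intros:
  "leib (gen i) b \<in> ideal_gens \<xi>"
  "of_sym (DDx i) \<star> of_sym (Dx j)
      + tscale (1 - qroot) (\<Sum>k\<in>UNIV. of_sym (DDx k) \<star> \<d> (xi_coord \<xi> i j k))
      - tscale (qroot\<^sup>2) (\<Sum>k\<in>UNIV. of_sym (Dx k) \<star> \<d> (\<d> (xi_coord \<xi> i j k))) \<in> ideal_gens \<xi>"
  "of_sym (DDx i) \<star> of_sym (DDx j)
      - tscale qroot (\<Sum>k\<in>UNIV. of_sym (DDx k) \<star> \<d> (\<d> (xi_coord \<xi> i j k))) \<in> ideal_gens \<xi>"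
proof -
  show "leib (gen i) b \<in> ideal_gens \<xi>"
  proof (cases b)
    case (Dx j)
    \<comment> \<open>The union of the seven families associates to the left, so the third lies
      behind four \<open>UnI1\<close>.\<close>
    show ?thesis
      unfolding ideal_gens_def Let_def Dx leib_gen
      by (rule UnI1, rule UnI1, rule UnI1, rule UnI1, rule UnI2) blast
  next
    case (DDx j)
    show ?thesis
      unfolding ideal_gens_def Let_def DDx leib_gen
      by (rule UnI1, rule UnI1, rule UnI1, rule UnI2) blast
  qed
qed (unfold ideal_gens_def Let_def, (rule UnI1, rule UnI1, rule UnI2, blast), (rule UnI2, blast))

lemma leib_in_tgrade: "leib a b \<in> tgrade (1 + sym_grade b)"
proof -
  have d: "\<d> (of_falg r) \<in> tgrade 1" for r
    using diff_in_tgrade[OF of_falg_in_tgrade] by simp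
  have "of_sym (map_bsym (\<lambda>_. k) b) \<star> \<d> (of_falg r) \<in> tgrade (1 + sym_grade b)" for k r
    using mul_in_tgrade[OF of_sym_in_tgrade d, of "map_bsym (\<lambda>_. k) b"]
    by (simp add: map_bsym_simps add.commute)
  then show ?thesis
    unfolding leib_def
    by (intro tgrade_diff tgrade_tscale tgrade_sum mul_in_tgrade[OF d of_sym_in_tgrade])
qed

text \<open>Homogeneity makes the quotient graded; positivity of the grade leaves the free algebra
  intact in grade 0.\<close>

lemma ideal_gens_homogeneous:
  assumes "g \<in> ideal_gens \<xi>"
  shows "\<exists>m. m \<noteq> 0 \<and> g \<in> tgrade m"
proof -
  have d: "\<d> (of_falg r) \<in> tgrade 1" "\<d> (\<d> (of_falg r)) \<in> tgrade 2"
    "\<d> (\<d> (\<d> (of_falg r))) \<in> tgrade 3" for r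
    using diff_in_tgrade[OF of_falg_in_tgrade] diff_in_tgrade[OF diff_in_tgrade[OF of_falg_in_tgrade]]
      diff_in_tgrade[OF diff_in_tgrade[OF diff_in_tgrade[OF of_falg_in_tgrade]]]
    by (auto simp: numeral_2_eq_2 numeral_3_eq_3)
  have s: "of_sym (Dx i) \<in> tgrade 1" "of_sym (DDx i) \<in> tgrade 2" for i
    using of_sym_in_tgrade[of "Dx i"] of_sym_in_tgrade[of "DDx i"] by simp_all
  have m: "of_sym (Dx i) \<star> \<d> (\<d> (of_falg r)) \<in> tgrade 3"
    "of_sym (DDx i) \<star> \<d> (of_falg r) \<in> tgrade 3"
    "of_sym (DDx i) \<star> \<d> (\<d> (of_falg r)) \<in> tgrade 4"
    "of_sym (DDx i) \<star> of_sym (Dx j) \<in> tgrade 3"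
    "of_sym (DDx i) \<star> of_sym (DDx j) \<in> tgrade 4" for i j r
    \<comment> \<open>\<open>mul_in_tgrade\<close> yields grades as sums such as 1 + 2;
      \<open>back_subst\<close> leaves the arithmetic to \<open>simp\<close>.\<close>
    by (rule mul_in_tgrade[OF s(1) d(2), THEN back_subst[of "\<lambda>m. _ \<in> tgrade m"]] mul_in_tgrade[OF s(2) d(1), THEN back_subst[of "\<lambda>m. _ \<in> tgrade m"]]
      mul_in_tgrade[OF s(2) d(2), THEN back_subst[of "\<lambda>m. _ \<in> tgrade m"]] mul_in_tgrade[OF s(2) s(1), THEN back_subst[of "\<lambda>m. _ \<in> tgrade m"]]
      mul_in_tgrade[OF s(2) s(2), THEN back_subst[of "\<lambda>m. _ \<in> tgrade m"]]; simp)+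
  from assms show ?thesis
  proof (cases rule: ideal_gens_cases)
    case rel0
    then show ?thesis by (auto simp: tgrade_zero)
  next
    case (leib i b)
    then show ?thesis using leib_in_tgrade[of "gen i" b] by (intro exI[of _ "1 + sym_grade b"]) simp
  next
    case rel5
    then show ?thesis using m
      by (intro exI[of _ 3]) (auto simp: xi_coord_def intro!: tgrade_diff tgrade_add tgrade_tscale tgrade_sum)
  next
    case rel6
    then show ?thesis using d by (intro exI[of _ 3]) auto
  next
    case rel7
    then show ?thesis using m
      by (intro exI[of _ 4]) (auto simp: xi_coord_def intro!: tgrade_diff tgrade_tscale tgrade_sum)
  qed
qed

lemma leib_ideal_subset: "leib_ideal \<subseteq> tideal (ideal_gens \<xi>)"
  unfolding leib_ideal_def
  by (rule tideal_least) (auto intro: tideal_base ideal_gens_intros)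

lemma diff_leib_ideal:
  assumes "x \<in> leib_ideal"
  shows "\<d> x \<in> tideal (ideal_gens \<xi>)"
  using assms unfolding leib_ideal_def
proof (rule diff_tideal[OF leib_ideal_subset, rotated])
  fix g assume "g \<in> {leib (gen i) b | i b. True}"
  then obtain i b where g: "g = leib (gen i) b" by blast
  have "\<d> (leib (gen i) b) \<in> tideal (ideal_gens \<xi>)"
  proof (cases b)
    case (Dx j)
    \<comment> \<open>The term q dx^i d^2x^j is eliminated by q times the fourth relation, which
      contributes q q^2 = 1 to the coefficient -q of the terms d^2x^k d\<xi>. This is the origin of
      1 - q in the fifth family.\<close>
    have "\<d> (leib (gen i) (Dx j)) = (of_sym (DDx i) \<star> of_sym (Dx j)
      + tscale (1 - qroot) (\<Sum>k\<in>UNIV. of_sym (DDx k) \<star> \<d> (xi_coord \<xi> i j k))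
      - tscale (qroot\<^sup>2) (\<Sum>k\<in>UNIV. of_sym (Dx k) \<star> \<d> (\<d> (xi_coord \<xi> i j k))))
      + tscale qroot (leib (gen i) (DDx j))"
      by (simp add: leib_def xi_coord_def diff_gen diff_diff diff_minus diff_scale diff_sum diff_sym_mul diff_of_sym
          sum.distrib sum_subtractf sum_negf tscale_add tscale_diff tscale_minus tscale_sum[symmetric] qroot_reduce)
    then show ?thesis
      unfolding Dx by (auto intro: tideal.add tideal_scale tideal_base ideal_gens_intros)
  next
    case (DDx j)
    \<comment> \<open>Each product loses the summand with a third derivative of a coordinate; the
      coefficient is q^2 q^2 = q.\<close>
    have "\<d> (leib (gen i) (DDx j)) = of_sym (DDx i) \<star> of_sym (DDx j)
      - tscale qroot (\<Sum>k\<in>UNIV. of_sym (DDx k) \<star> \<d> (\<d> (xi_coord \<xi> i j k)))"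
      by (simp add: leib_def xi_coord_def diff_gen diff_diff diff_minus diff_scale diff_sum diff_sym_mul diff_of_sym
          mul_zero diff_zero tscale_zero sum.distrib sum_subtractf sum_negf tscale_add tscale_diff tscale_minus tscale_sum[symmetric] qroot_reduce)
    then show ?thesis
      unfolding DDx by (auto intro: tideal_base ideal_gens_intros)
  qed
  then show "g \<in> tideal (ideal_gens \<xi>) \<and> \<d> g \<in> tideal (ideal_gens \<xi>) \<and> (\<exists>m. g \<in> tgrade m)"
    using g leib_in_tgrade by (auto intro: tideal_base ideal_gens_intros)
qed

lemma diff3_in_ideal: "\<d> (\<d> (\<d> t)) \<in> tideal (ideal_gens \<xi>)"
  by (rule diff3_in_tideal[OF leib_ideal_subset diff_leib_ideal])

lemma diff_ideal:
  assumes "x \<in> tideal (ideal_gens \<xi>)"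
  shows "\<d> x \<in> tideal (ideal_gens \<xi>)"
proof (rule diff_tideal[OF leib_ideal_subset _ assms])
  fix g assume gen: "g \<in> ideal_gens \<xi>"
  then have "\<d> g \<in> tideal (ideal_gens \<xi>)"
  proof (cases rule: ideal_gens_cases)
    case rel0
    then show ?thesis by (simp add: diff_zero tideal.zero)
  next
    case (leib i b)
    then show ?thesis using diff_leib_ideal leib_in_leib_ideal by blast
  next
    case (rel5 i j)
    \<comment> \<open>The terms d^2x^k d^2\<xi> collect (1 - q) q^2 - q^2 = -1, which is q^2 times
      the coefficient -q in the last family.\<close>
    have "\<d> g = tscale (qroot\<^sup>2) (of_sym (DDx i) \<star> of_sym (DDx j)
        - tscale qroot (\<Sum>k\<in>UNIV. of_sym (DDx k) \<star> \<d> (\<d> (xi_coord \<xi> i j k))))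
        - (\<Sum>k\<in>UNIV. of_sym (Dx k) \<star> \<d> (\<d> (\<d> (xi_coord \<xi> i j k))))"
      unfolding rel5
      by (simp add: diff_add diff_diff diff_minus diff_scale diff_sum diff_sym_mul diff_of_sym
          mul_zero diff_zero tscale_zero sum.distrib sum_subtractf sum_negf tscale_add tscale_diff tscale_minus tscale_sum[symmetric] qroot_reduce)
    then show ?thesis
      using diff3_in_ideal
      by (auto intro!: tideal_diff tideal_scale[OF tideal_base[OF ideal_gens_intros(3)]] tideal_sum tideal_left)
  next
    case (rel6 r)
    \<comment> \<open>The derivative of d^3 r is the third derivative of d r.\<close>
    then show ?thesis using diff3_in_ideal by simp
  next
    case (rel7 i j)
    have "\<d> g = - (\<Sum>k\<in>UNIV. of_sym (DDx k) \<star> \<d> (\<d> (\<d> (xi_coord \<xi> i j k))))"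
      unfolding rel7
      by (simp add: diff_add diff_diff diff_minus diff_scale diff_sum diff_sym_mul diff_of_sym
          mul_zero diff_zero tscale_zero sum.distrib sum_subtractf sum_negf tscale_add tscale_diff tscale_minus tscale_sum[symmetric] qroot_reduce)
    then show ?thesis
      using diff3_in_ideal by (auto intro!: tideal_minus tideal_sum tideal_left)
  qed
  then show "g \<in> tideal (ideal_gens \<xi>) \<and> \<d> g \<in> tideal (ideal_gens \<xi>) \<and> (\<exists>m. g \<in> tgrade m)"
    using gen ideal_gens_homogeneous by (auto intro: tideal_base)
qed

section \<open>The quotient algebra\<close>

lemma tensor_alg_simps:
  "carrier (tensor_alg \<xi>) = UNIV" "mult (tensor_alg \<xi>) = tmul \<xi>" "one (tensor_alg \<xi>) = of_falg 1"
  "zero (tensor_alg \<xi>) = 0" "add (tensor_alg \<xi>) = (+)" "smult (tensor_alg \<xi>) = tscale"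
  by (simp_all add: tensor_alg_def)

lemma ideal_tideal: "ideal (tideal G) (tensor_alg \<xi>)"
proof (rule idealI)
  interpret ring "tensor_alg \<xi>" by (rule ring_tensor_alg[OF hom])
  show "subgroup (tideal G) (add_monoid (tensor_alg \<xi>))"
  proof (rule group.subgroupI)
    show "group (add_monoid (tensor_alg \<xi>))" by (rule a_group)
  next
    fix a assume a: "a \<in> tideal G"
    have "\<ominus>\<^bsub>tensor_alg \<xi>\<^esub> a = - a"
      by (rule minus_equality) (simp_all add: tensor_alg_simps)
    with a show "inv\<^bsub>add_monoid (tensor_alg \<xi>)\<^esub> a \<in> tideal G"
      by (simp add: a_inv_def tideal_minus)
  qed (auto simp: tensor_alg_simps intro: tideal.zero tideal.add)
qed (auto simp: ring_tensor_alg[OF hom] tensor_alg_simps tideal_left tideal_right)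

text \<open>\<open>Idl\<close> is an intersection of ideals; the inductive description provides the
  induction over its elements.\<close>

lemma Iq_eq_tideal: "Iq \<xi> = tideal (ideal_gens \<xi>)"
proof
  interpret ring "tensor_alg \<xi>" by (rule ring_tensor_alg[OF hom])
  show "Iq \<xi> \<subseteq> tideal (ideal_gens \<xi>)"
    unfolding Iq_def by (rule genideal_minimal[OF ideal_tideal]) (auto intro: tideal_base)
  interpret I: ideal "Iq \<xi>" "tensor_alg \<xi>"
    unfolding Iq_def by (rule genideal_ideal) (simp add: tensor_alg_simps)
  have gens: "ideal_gens \<xi> \<subseteq> Iq \<xi>"
    unfolding Iq_def by (rule genideal_self) (simp add: tensor_alg_simps)
  show "tideal (ideal_gens \<xi>) \<subseteq> Iq \<xi>"
  proof
    fix x assume "x \<in> tideal (ideal_gens \<xi>)"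
    then show "x \<in> Iq \<xi>"
    proof induction
      case zero
      show ?case using I.zero_closed by (simp add: tensor_alg_simps)
    next
      case (add x y)
      then show ?case using I.a_closed[of x y] by (simp add: tensor_alg_simps)
    next
      case (sandwich g s m t k)
      then show ?case
        using gens I.I_l_closed[of g s] I.I_r_closed[of "s \<star> g" t] by (auto simp: tensor_alg_simps)
    qed
  qed
qed

lemma ideal_Iq: "ideal (Iq \<xi>) (tensor_alg \<xi>)"
  unfolding Iq_eq_tideal by (rule ideal_tideal)

lemma Omega_class_eq: "Omega_class \<xi> s = Omega_class \<xi> t \<longleftrightarrow> s - t \<in> Iq \<xi>"
proof -
  have *: "Omega_class \<xi> t = {x. x - t \<in> Iq \<xi>}" for t
    by (force simp: Omega_class_def a_r_coset_def' tensor_alg_simps)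
  show ?thesis
  proof
    assume "Omega_class \<xi> s = Omega_class \<xi> t"
    moreover have "s \<in> Omega_class \<xi> s" by (simp add: * Iq_eq_tideal tideal.zero)
    ultimately show "s - t \<in> Iq \<xi>" by (simp add: *)
  next
    assume st: "s - t \<in> Iq \<xi>"
    have "x - s \<in> Iq \<xi> \<longleftrightarrow> x - t \<in> Iq \<xi>" for x
      using st tideal.add[of "x - s" _ "s - t"] tideal_diff[of "x - t" _ "s - t"]
      by (auto simp: Iq_eq_tideal)
    then show "Omega_class \<xi> s = Omega_class \<xi> t" by (simp add: *)
  qed
qed

lemma Omega_class_eq_zero: "Omega_class \<xi> t = Omega_class \<xi> 0 \<longleftrightarrow> t \<in> Iq \<xi>"
  by (simp add: Omega_class_eq)

lemma Omega_carrier: "carrier (Omega \<xi>) = range (Omega_class \<xi>)"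
  by (auto simp: Omega_def quot_alg_def ring.defs FactRing_def A_RCOSETS_def' Omega_class_def tensor_alg_simps)

lemma Omega_add: "Omega_class \<xi> s \<oplus>\<^bsub>Omega \<xi>\<^esub> Omega_class \<xi> t = Omega_class \<xi> (s + t)"
  using ideal.a_rcos_sum[OF ideal_Iq, of s t]
  by (simp add: Omega_def quot_alg_def ring.defs FactRing_def Omega_class_def tensor_alg_simps)

lemma Omega_mult: "Omega_class \<xi> s \<otimes>\<^bsub>Omega \<xi>\<^esub> Omega_class \<xi> t = Omega_class \<xi> (s \<star> t)"
  using ideal.rcoset_mult_add[OF ideal_Iq, of s t]
  by (simp add: Omega_def quot_alg_def ring.defs FactRing_def Omega_class_def tensor_alg_simps)

lemma Omega_one: "\<one>\<^bsub>Omega \<xi>\<^esub> = Omega_class \<xi> (of_falg 1)"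
  by (simp add: Omega_def quot_alg_def ring.defs FactRing_def Omega_class_def tensor_alg_simps)

lemma Omega_zero: "\<zero>\<^bsub>Omega \<xi>\<^esub> = Omega_class \<xi> 0"
  by (simp add: Omega_def quot_alg_def ring.defs FactRing_def Omega_class_def tensor_alg_simps a_r_coset_def')

text \<open>In \<open>quot_alg\<close> the scaled class is a union over all representatives. Their
  scaled cosets coincide, and the union is not empty, so it collapses to one coset.\<close>

lemma Omega_smult: "c \<odot>\<^bsub>Omega \<xi>\<^esub> Omega_class \<xi> t = Omega_class \<xi> (tscale c t)"
proof -
  have t: "t \<in> Omega_class \<xi> t"
    by (force simp: Omega_class_def a_r_coset_def' tensor_alg_simps Iq_eq_tideal intro: tideal.zero)
  have "Omega_class \<xi> (tscale c x) = Omega_class \<xi> (tscale c t)" if "x \<in> Omega_class \<xi> t" for x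
  proof -
    have "x - t \<in> Iq \<xi>" using that by (auto simp: Omega_class_def a_r_coset_def' tensor_alg_simps)
    then show ?thesis
      by (simp add: Omega_class_eq Iq_eq_tideal tideal_scale flip: tscale_diff)
  qed
  with t have "(\<Union>x\<in>Omega_class \<xi> t. Omega_class \<xi> (tscale c x)) = Omega_class \<xi> (tscale c t)"
    by blast
  then show ?thesis
    by (simp add: Omega_def quot_alg_def ring.defs module.defs tensor_alg_simps Omega_class_def)
qed

lemmas Omega_simps = Omega_carrier Omega_add Omega_mult Omega_one Omega_zero Omega_smult

lemma abelian_group_Omega: "abelian_group (Omega \<xi>)"
proof (rule abelian_groupI)
  fix x assume "x \<in> carrier (Omega \<xi>)"
  then obtain t where x: "x = Omega_class \<xi> t" by (auto simp: Omega_carrier)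
  have "Omega_class \<xi> (- t) \<oplus>\<^bsub>Omega \<xi>\<^esub> x = \<zero>\<^bsub>Omega \<xi>\<^esub>" by (simp add: x Omega_simps)
  then show "\<exists>y\<in>carrier (Omega \<xi>). y \<oplus>\<^bsub>Omega \<xi>\<^esub> x = \<zero>\<^bsub>Omega \<xi>\<^esub>"
    by (auto simp: Omega_carrier)
qed (auto simp: Omega_simps add_ac)

lemma ring_Omega: "ring (Omega \<xi>)"
proof (rule ringI[OF abelian_group_Omega])
  show "monoid (Omega \<xi>)"
    by (rule monoidI) (auto simp: Omega_simps mul_assoc mul_one_left mul_one_right)
qed (auto simp: Omega_simps mul_add_left mul_add_right)

lemma cring_complex_ring: "cring complex_ring"
proof (rule cringI)
  show "abelian_group complex_ring"
    by (rule abelian_groupI) (auto simp: complex_ring_def add_ac intro: exI[of _ "- _"])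
  show "comm_monoid complex_ring"
    by (rule comm_monoidI) (auto simp: complex_ring_def)
qed (auto simp: complex_ring_def algebra_simps)

lemma complex_algebra_Omega: "complex_algebra (Omega \<xi>)"
proof (intro complex_algebra.intro complex_algebra_axioms.intro)
  show "module complex_ring (Omega \<xi>)"
    by (rule moduleI[OF cring_complex_ring abelian_group_Omega])
      (auto simp: Omega_simps complex_ring_def tscale_add tscale_add_left tscale_tscale tscale_one)
qed (auto simp: ring_Omega Omega_simps tscale_mul_left tscale_mul_right)

section \<open>The grading of the quotient\<close>

lemma finsum_Omega:
  assumes "finite S"
  shows "finsum (Omega \<xi>) (\<lambda>m. Omega_class \<xi> (h m)) S = Omega_class \<xi> (\<Sum>m\<in>S. h m)"
proof -
  interpret abelian_group "Omega \<xi>" by (rule abelian_group_Omega)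
  show ?thesis
    using assms by induction (simp_all add: Pi_def Omega_simps)
qed

lemma hproj_Iq: "x \<in> Iq \<xi> \<Longrightarrow> hproj m x \<in> Iq \<xi>"
  unfolding Iq_eq_tideal by (rule hproj_tideal) (use ideal_gens_homogeneous in blast)

text \<open>The components are the classes of the homogeneous components of any representative;
  uniqueness holds because \<open>Iq\<close> is stable under \<open>hproj\<close>.\<close>

lemma Omega_grade_decomp:
  assumes "x \<in> carrier (Omega \<xi>)"
  shows "\<exists>!f. (\<forall>m. f m \<in> Omega_grade \<xi> m) \<and> finite {m. f m \<noteq> \<zero>\<^bsub>Omega \<xi>\<^esub>} \<and>
    x = finsum (Omega \<xi>) f {m. f m \<noteq> \<zero>\<^bsub>Omega \<xi>\<^esub>}"
proof -
  obtain t where x: "x = Omega_class \<xi> t" using assms by (auto simp: Omega_carrier)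
  have eq_proj: "f = (\<lambda>m. Omega_class \<xi> (hproj m t))"
    if grade: "\<forall>m. f m \<in> Omega_grade \<xi> m" and fin: "finite S" and sum: "x = finsum (Omega \<xi>) f S"
      and S: "\<forall>m. m \<notin> S \<longrightarrow> f m = \<zero>\<^bsub>Omega \<xi>\<^esub>" for f S
  proof
    fix k
    have "\<exists>h. h \<in> tgrade m \<and> f m = Omega_class \<xi> h" for m
      using spec[OF grade, of m] by (auto simp: Omega_grade_def)
    then obtain h where h: "\<And>m. h m \<in> tgrade m" and f: "\<And>m. f m = Omega_class \<xi> (h m)" by metis
    have "f = (\<lambda>m. Omega_class \<xi> (h m))" by (rule ext) (rule f)
    then have "Omega_class \<xi> t = Omega_class \<xi> (\<Sum>m\<in>S. h m)"
      using sum fin by (simp add: x finsum_Omega)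
    then have "(\<Sum>m\<in>S. h m) - t \<in> Iq \<xi>"
      by (intro Omega_class_eq[THEN iffD1]) (rule sym)
    from hproj_Iq[OF this, of k] have "hproj k (\<Sum>m\<in>S. h m) - hproj k t \<in> Iq \<xi>"
      by (simp add: hproj_diff)
    moreover have "hproj k (\<Sum>m\<in>S. h m) = (\<Sum>m\<in>S. hproj k (h m))"
      by (rule additive_sum) (rule hproj_add)
    moreover have "\<dots> = (if k \<in> S then h k else 0)"
      using fin by (simp add: hproj_tgrade[OF h])
    ultimately have "Omega_class \<xi> (if k \<in> S then h k else 0) = Omega_class \<xi> (hproj k t)"
      by (simp add: Omega_class_eq)
    then show "f k = Omega_class \<xi> (hproj k t)"
      by (cases "k \<in> S") (simp_all add: f[symmetric] S Omega_zero)
  qed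
  let ?f = "\<lambda>m. Omega_class \<xi> (hproj m t)" and ?S = "word_grade ` Poly_Mapping.keys t"
  let ?Z = "{m. ?f m \<noteq> \<zero>\<^bsub>Omega \<xi>\<^esub>}"
  have Z: "?Z \<subseteq> ?S"
  proof (rule subsetI, rule ccontr)
    fix m assume "m \<in> ?Z" "m \<notin> ?S"
    then show False by (simp add: hproj_eq_zero Omega_zero)
  qed
  have fin: "finite ?Z" by (rule finite_subset[OF Z]) simp
  \<comment> \<open>An index outside \<open>?Z\<close> may still carry a nonzero component of
    \<open>t\<close>, but that component lies in \<open>Iq\<close> and does not change the
    class.\<close>
  have "Omega_class \<xi> (\<Sum>m\<in>?Z. hproj m t) = Omega_class \<xi> (\<Sum>m\<in>?S. hproj m t)"
  proof -
    have "(\<Sum>m\<in>?S. hproj m t) - (\<Sum>m\<in>?Z. hproj m t) = (\<Sum>m\<in>?S - ?Z. hproj m t)"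
      using Z by (simp add: sum_diff)
    also have "\<dots> \<in> Iq \<xi>"
      unfolding Iq_eq_tideal
      by (rule tideal_sum) (auto simp: Omega_zero Omega_class_eq_zero Iq_eq_tideal)
    finally show ?thesis by (rule Omega_class_eq[THEN iffD2, symmetric])
  qed
  then have sum: "x = finsum (Omega \<xi>) ?f ?Z"
    using fin by (simp add: x finsum_Omega sum_hproj)
  show ?thesis
  proof (rule ex1I[of _ ?f])
    show "(\<forall>m. ?f m \<in> Omega_grade \<xi> m) \<and> finite ?Z \<and> x = finsum (Omega \<xi>) ?f ?Z"
      using fin sum by (intro conjI) (auto simp only: Omega_grade_def intro!: imageI hproj_in_tgrade)
  next
    fix f
    assume f: "(\<forall>m. f m \<in> Omega_grade \<xi> m) \<and> finite {m. f m \<noteq> \<zero>\<^bsub>Omega \<xi>\<^esub>} \<and>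
      x = finsum (Omega \<xi>) f {m. f m \<noteq> \<zero>\<^bsub>Omega \<xi>\<^esub>}"
    show "f = ?f"
    proof (rule eq_proj)
      show "\<forall>m. f m \<in> Omega_grade \<xi> m" "finite {m. f m \<noteq> \<zero>\<^bsub>Omega \<xi>\<^esub>}"
        "x = finsum (Omega \<xi>) f {m. f m \<noteq> \<zero>\<^bsub>Omega \<xi>\<^esub>}"
        using f by blast+
    qed simp
  qed
qed

lemma submodule_Omega_grade: "submodule (Omega_grade \<xi> m) complex_ring (Omega \<xi>)"
proof -
  interpret complex_algebra "Omega \<xi>" by (rule complex_algebra_Omega)
  show ?thesis
  proof (rule submoduleI)
    fix a assume "a \<in> Omega_grade \<xi> m"
    then obtain t where t: "t \<in> tgrade m" and a: "a = Omega_class \<xi> t" by (auto simp: Omega_grade_def)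
    have "\<ominus>\<^bsub>Omega \<xi>\<^esub> a = Omega_class \<xi> (0 - t)"
      by (rule minus_equality) (auto simp: a Omega_simps)
    then show "\<ominus>\<^bsub>Omega \<xi>\<^esub> a \<in> Omega_grade \<xi> m"
      using t tgrade_diff[OF tgrade_zero] unfolding Omega_grade_def by blast
  qed (auto simp: Omega_grade_def Omega_simps intro!: imageI intro: tgrade_zero tgrade_add tgrade_tscale)
qed

lemma graded_complex_algebra_Omega: "graded_complex_algebra (Omega \<xi>) (Omega_grade \<xi>)"
  by (intro graded_complex_algebra.intro graded_complex_algebra_axioms.intro complex_algebra_Omega
      submodule_Omega_grade Omega_grade_decomp)
    (auto simp: Omega_grade_def Omega_one Omega_mult of_falg_in_tgrade mul_in_tgrade)

text \<open>Every generator has positive grade, so no element of the ideal has a component of grade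
  0.\<close>

lemma Iq_grade_zero: "of_falg r \<in> Iq \<xi> \<longleftrightarrow> r = 0"
proof
  have "hproj 0 x = 0" if "x \<in> Iq \<xi>" for x
    using that unfolding Iq_eq_tideal
  proof induction
    case (sandwich g s a t b)
    obtain m where "m \<noteq> 0" "g \<in> tgrade m" using ideal_gens_homogeneous sandwich(1) by blast
    with sandwich show ?case by (simp add: hproj_tgrade[OF mul_in_tgrade[OF mul_in_tgrade]])
  qed (simp_all add: hproj_zero hproj_add)
  moreover assume "of_falg r \<in> Iq \<xi>"
  ultimately have "of_falg r = 0" using hproj_tgrade[OF of_falg_in_tgrade, of 0 r] by simp
  then show "r = 0" by (metis of_falg_def lookup_single_eq lookup_zero)
qed (simp add: of_falg_zero Iq_eq_tideal tideal.zero)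

lemma tgrade_0: "t \<in> tgrade 0 \<Longrightarrow> \<exists>r. t = of_falg r"
proof (induction rule: tgrade_induct)
  case zero
  show ?case by (metis of_falg_zero)
next
  case (single w r)
  have "w = []"
  proof (cases w)
    case (Cons b v)
    with single show ?thesis by (cases b) (simp_all add: word_grade_simps)
  qed simp
  then show ?case by (auto simp: of_falg_def)
next
  case (add s t)
  then show ?case by (metis of_falg_add)
qed

section \<open>The induced differential\<close>

definition Omega_diff :: "'n tens set \<Rightarrow> 'n tens set" where
  "Omega_diff X = Omega_class \<xi> (\<d> (SOME t. X = Omega_class \<xi> t))"

lemma Omega_diff_class: "Omega_diff (Omega_class \<xi> t) = Omega_class \<xi> (\<d> t)"
proof -
  have "Omega_class \<xi> t = Omega_class \<xi> (SOME s. Omega_class \<xi> t = Omega_class \<xi> s)"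
    by (rule someI[of "\<lambda>s. Omega_class \<xi> t = Omega_class \<xi> s" t]) (rule refl)
  then show ?thesis
    unfolding Omega_diff_def Omega_class_eq
    using diff_ideal tideal_minus by (metis (no_types, lifting) Iq_eq_tideal diff_diff minus_diff_eq)
qed

lemma Omega_diff_leibniz:
  assumes "s \<in> tgrade m"
  shows "Omega_class \<xi> (\<d> (s \<star> t)) =
    Omega_class \<xi> (\<d> s \<star> t + tscale (qroot ^ m) (s \<star> \<d> t))"
  using lerr_in_leib_ideal[OF assms, of t] leib_ideal_subset
  by (auto simp: Omega_class_eq Iq_eq_tideal lerr_def algebra_simps)

lemma ternary_gda_Omega:
  "ternary_gda (Omega \<xi>) (Omega_grade \<xi>) free_alg (\<lambda>r. Omega_class \<xi> (of_falg r)) Omega_diff"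
proof (intro ternary_gda.intro ternary_gda_axioms.intro graded_complex_algebra_Omega)
  show "(\<lambda>r. Omega_class \<xi> (of_falg r)) \<in> ring_hom free_alg (Omega \<xi>)"
    by (rule ring_hom_memI) (auto simp: free_alg_def Omega_simps of_falg_mult of_falg_add)
  show "bij_betw (\<lambda>r. Omega_class \<xi> (of_falg r)) (carrier free_alg) (Omega_grade \<xi> 0)"
  proof (rule bij_betw_imageI)
    show "inj_on (\<lambda>r. Omega_class \<xi> (of_falg r)) (carrier free_alg)"
    proof (rule inj_onI)
      fix r r' :: "'n falg" assume "Omega_class \<xi> (of_falg r) = Omega_class \<xi> (of_falg r')"
      then have "of_falg (r - r') \<in> Iq \<xi>"
        using of_falg_add[of "r - r'" r'] by (simp add: Omega_class_eq)
      then show "r = r'" by (simp add: Iq_grade_zero)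
    qed
    show "(\<lambda>r. Omega_class \<xi> (of_falg r)) ` carrier free_alg = Omega_grade \<xi> 0"
      using tgrade_0 of_falg_in_tgrade by (fastforce simp: free_alg_def Omega_grade_def)
  qed
next
  fix x y m assume "x \<in> Omega_grade \<xi> m" "y \<in> carrier (Omega \<xi>)"
  then obtain s t where s: "s \<in> tgrade m" and xy: "x = Omega_class \<xi> s" "y = Omega_class \<xi> t"
    by (auto simp: Omega_grade_def Omega_carrier)
  show "Omega_diff (x \<otimes>\<^bsub>Omega \<xi>\<^esub> y) =
      Omega_diff x \<otimes>\<^bsub>Omega \<xi>\<^esub> y \<oplus>\<^bsub>Omega \<xi>\<^esub> qroot ^ m \<odot>\<^bsub>Omega \<xi>\<^esub> (x \<otimes>\<^bsub>Omega \<xi>\<^esub> Omega_diff y)"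
    by (simp add: xy Omega_simps Omega_diff_class Omega_diff_leibniz[OF s])
next
  have "Omega_class \<xi> (\<d> (\<d> (\<d> t))) = Omega_class \<xi> 0" for t
    using diff3_in_ideal unfolding Omega_class_eq_zero Iq_eq_tideal .
  moreover fix x assume "x \<in> carrier (Omega \<xi>)"
  ultimately show "Omega_diff (Omega_diff (Omega_diff x)) = \<zero>\<^bsub>Omega \<xi>\<^esub>"
    by (auto simp only: Omega_carrier Omega_diff_class Omega_zero)
next
  fix x m assume "x \<in> Omega_grade \<xi> m"
  then show "Omega_diff x \<in> Omega_grade \<xi> (m + 1)"
    using diff_in_tgrade by (auto simp: Omega_grade_def Omega_diff_class)
qed (auto simp: Omega_simps Omega_diff_class diff_add diff_scale free_alg_def of_falg_def tscale_single)

end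

text \<open>The carrier consists of the classes, so the first conjunct determines the operator there
  and expresses that it is well defined.\<close>

theorem theorem2p3:
  fixes \<xi> :: "'n::finite falg \<Rightarrow> 'n falg ^ 'n ^ 'n"
  assumes "mat_alg_hom \<xi>"
  shows "\<exists>d\<Omega>. (\<forall>t. d\<Omega> (Omega_class \<xi> t) = Omega_class \<xi> (tdiff \<xi> t)) \<and>
    ternary_gda (Omega \<xi>) (Omega_grade \<xi>) free_alg (\<lambda>r. Omega_class \<xi> (of_falg r)) d\<Omega>"
  using Omega_diff_class[OF assms] ternary_gda_Omega[OF assms] by blast

end
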